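(* Let $R$ be a left Artinian unital local ring such that $\mathrm{rad}(R)$ is generated (as an ideal) by a central element $c$. Let $n$ be the smallest positive integer such that $c^n=0$. Then $\mathrm{W}_{\mathrm{M}}(R)$ is the free abelian monoid generated by $\langle c^i\rangle_{\mathrm{M}}$ for $i=0, 1, \dots, n-1$, i.e. $\mathrm{W}_{\mathrm{M}}(R)=\bigoplus_{0\le i\le n-1}\mathbb{Z}_{\ge 0}\langle c^i\rangle_{\mathrm{M}}$. Furthermore, for any $a, b\in \mathrm{W}_{\mathrm{M}}(R)$, the following are equivalent: (1) $a\preceq_{\mathrm{M}} b$; (2) $\mathrm{rk}(a)\le \mathrm{rk}(b)$ for all $\mathrm{rk}\in \mathbb{P}(R)$; (3) $\mathrm{rk}_k(a)\le \mathrm{rk}_k(b)$ for all $k=1, \dots, n$.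
   Context: Unital rings are nonzero. A unital ring is local if its non-invertible elements form an ideal, which is then the Jacobson radical $\mathrm{rad}(R)$; for left Artinian $R$ it is nilpotent, so $n$ exists. $c^0=1$. $M(R)$ is the set of all rectangular matrices over $R$. Matrix Malcolmson semigroup. For $A,B\in M(R)$ write $A\lesssim B$ if either $A=CBD$ for some $C,D\in M(R)$, or $B=\begin{bmatrix}C&E\\0&D\end{bmatrix}$ and $A=\begin{bmatrix}C&0\\0&D\end{bmatrix}$ for some $C,D,E\in M(R)$. Write $A\preceq_{\mathrm{M}}B$ if there is a finite chain $A=A_1\lesssim\dots\lesssim A_l=B$ in $M(R)$, and $A\sim_{\mathrm{M}}B$ if $A\preceq_{\mathrm{M}}B\preceq_{\mathrm{M}}A$. $\mathrm{W}_{\mathrm{M}}(R)=M(R)/\sim_{\mathrm{M}}$, with classes $\langle A\rangle_{\mathrm{M}}$, is an abelian monoid under $\langle A\rangle_{\mathrm{M}}+\langle B\rangle_{\mathrm{M}}=\langle\mathrm{diag}(A,B)\rangle_{\mathrm{M}}$, with identity $\langle0\rangle_{\mathrm{M}}$, partially ordered by $\langle A\rangle_{\mathrm{M}}\preceq_{\mathrm{M}}\langle B\rangle_{\mathrm{M}}$ iff $A\preceq_{\mathrm{M}}B$. $\mathbb{P}(R)$ is the set of Sylvester matrix rank functions for $R$, i.e. functions $\mathrm{rk}:M(R)\to\mathbb{R}_{\ge0}$ such that (i) $\mathrm{rk}(0)=0$ (for every zero matrix) and $\mathrm{rk}(1)=1$; (ii) $\mathrm{rk}(AB)\le\min(\mathrm{rk}(A),\mathrm{rk}(B))$;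 (iii) $\mathrm{rk}(\mathrm{diag}(A,B))=\mathrm{rk}(A)+\mathrm{rk}(B)$; (iv) $\mathrm{rk}\left(\begin{bmatrix}A&C\\0&B\end{bmatrix}\right)\ge\mathrm{rk}(A)+\mathrm{rk}(B)$. Each $\mathrm{rk}\in\mathbb{P}(R)$ factors through $\mathrm{W}_{\mathrm{M}}(R)$, and the induced map on $\mathrm{W}_{\mathrm{M}}(R)$ is denoted by the same symbol: $\mathrm{rk}(\langle A\rangle_{\mathrm{M}})=\mathrm{rk}(A)$. For $1\le k\le n$, $\mathrm{rk}_k\in\mathbb{P}(R)$ denotes the Sylvester matrix rank function satisfying $\mathrm{rk}_k(c^i)=\frac{k-i}{k}$ for $0\le i<k$ and $\mathrm{rk}_k(c^i)=0$ for $k\le i\le n-1$; such $\mathrm{rk}_k$ exists by a known result of Jiang and Li. *)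

theory Defs
  imports Complex_Main "HOL-Library.FuncSet" "Jordan_Normal_Form.Matrix"
begin

section \<open>Rings\<close>

text \<open>The ring is a type of class \<open>ring_1\<close>, so it is unital, nonzero and not necessarily
  commutative. The ring notions of the library are stated either for commutative type classes or for
  explicit carriers, so the few that are needed are set up here.\<close>

definition left_ideal :: "'a::ring_1 set \<Rightarrow> bool" where
  "left_ideal I \<longleftrightarrow> 0 \<in> I \<and> (\<forall>x\<in>I. \<forall>y\<in>I. x + y \<in> I) \<and> (\<forall>r. \<forall>x\<in>I. r * x \<in> I)"

definition two_sided_ideal :: "'a::ring_1 set \<Rightarrow> bool" where
  "two_sided_ideal I \<longleftrightarrow> left_ideal I \<and> (\<forall>r. \<forall>x\<in>I. x * r \<in> I)"

definition invertible_elements :: "'a::ring_1 set" where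
  "invertible_elements = {x. \<exists>y. x * y = 1 \<and> y * x = 1}"

definition local_ring :: "'a::ring_1 itself \<Rightarrow> bool" where
  "local_ring _ \<longleftrightarrow> two_sided_ideal (- (invertible_elements :: 'a set))"

definition left_artinian :: "'a::ring_1 itself \<Rightarrow> bool" where
  "left_artinian _ \<longleftrightarrow>
     (\<forall>I :: nat \<Rightarrow> 'a set. (\<forall>k. left_ideal (I k)) \<and> (\<forall>k. I (Suc k) \<subseteq> I k)
        \<longrightarrow> (\<exists>N. \<forall>k\<ge>N. I k = I N))"

definition maximal_left_ideal :: "'a::ring_1 set \<Rightarrow> bool" where
  "maximal_left_ideal I \<longleftrightarrow> left_ideal I \<and> I \<noteq> UNIV
     \<and> (\<forall>J. left_ideal J \<and> I \<subseteq> J \<longrightarrow> J = I \<or> J = UNIV)"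

definition jacobson_radical :: "'a::ring_1 set" where
  "jacobson_radical = \<Inter> {I. maximal_left_ideal I}"

definition ring_center :: "'a::ring_1 set" where
  "ring_center = {c. \<forall>x. c * x = x * c}"


section \<open>The matrix Malcolmson semigroup\<close>

text \<open>The library type of matrices also contains matrices without rows or without columns;
  these are not counted as rectangular matrices here.\<close>

definition rect_mats :: "'a mat set" where
  "rect_mats = {A. 0 < dim_row A \<and> 0 < dim_col A}"

definition diag_sum :: "'a::zero mat \<Rightarrow> 'a mat \<Rightarrow> 'a mat" where
  "diag_sum A B =
     four_block_mat A (0\<^sub>m (dim_row A) (dim_col B)) (0\<^sub>m (dim_row B) (dim_col A)) B"

definition upper_block :: "'a::zero mat \<Rightarrow> 'a mat \<Rightarrow> 'a mat \<Rightarrow> 'a mat" where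
  "upper_block A E B = four_block_mat A E (0\<^sub>m (dim_row B) (dim_col A)) B"

definition elem_mat :: "'a \<Rightarrow> 'a mat" where
  "elem_mat x = mat 1 1 (\<lambda>_. x)"

inductive malc_step :: "'a::ring_1 mat \<Rightarrow> 'a mat \<Rightarrow> bool" where
  prod: "\<lbrakk>C \<in> rect_mats; B \<in> rect_mats; D \<in> rect_mats; dim_col C = dim_row B; dim_col B = dim_row D\<rbrakk>
    \<Longrightarrow> malc_step (C * B * D) B"
| block: "\<lbrakk>C \<in> rect_mats; D \<in> rect_mats; E \<in> carrier_mat (dim_row C) (dim_col D)\<rbrakk>
    \<Longrightarrow> malc_step (diag_sum C D) (upper_block C E D)"

definition malc_le :: "'a::ring_1 mat \<Rightarrow> 'a mat \<Rightarrow> bool" where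
  "malc_le A B \<longleftrightarrow> A \<in> rect_mats \<and> B \<in> rect_mats \<and> malc_step\<^sup>*\<^sup>* A B"

definition malc_equiv :: "'a::ring_1 mat \<Rightarrow> 'a mat \<Rightarrow> bool" where
  "malc_equiv A B \<longleftrightarrow> malc_le A B \<and> malc_le B A"

lemma malc_le_refl: "A \<in> rect_mats \<Longrightarrow> malc_le A A"
  by (simp add: malc_le_def)

lemma malc_le_trans: "malc_le A B \<Longrightarrow> malc_le B C \<Longrightarrow> malc_le A C"
  by (auto simp: malc_le_def)

lemma malc_equiv_refl_iff: "malc_equiv A A \<longleftrightarrow> A \<in> rect_mats"
  by (auto simp: malc_equiv_def malc_le_def)

lemma malc_le_prod:
  assumes "C \<in> rect_mats" "B \<in> rect_mats" "D \<in> rect_mats"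
    "dim_col C = dim_row B" "dim_col B = dim_row D"
  shows "malc_le (C * B * D) B"
  using malc_step.prod[OF assms] assms by (auto simp: malc_le_def rect_mats_def)

lemma diag_sum_dim [simp]:
  "dim_row (diag_sum A B) = dim_row A + dim_row B"
  "dim_col (diag_sum A B) = dim_col A + dim_col B"
  by (simp_all add: diag_sum_def)

lemma upper_block_dim [simp]:
  "dim_row (upper_block A E B) = dim_row A + dim_row B"
  "dim_col (upper_block A E B) = dim_col A + dim_col B"
  by (simp_all add: upper_block_def)

lemma elem_mat_rect [simp]: "elem_mat x \<in> rect_mats"
  by (simp add: elem_mat_def rect_mats_def)

lemma diag_sum_rect: "A \<in> rect_mats \<Longrightarrow> B \<in> rect_mats \<Longrightarrow> diag_sum A B \<in> rect_mats"
  by (simp add: rect_mats_def)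

lemma diag_sum_assoc: "diag_sum (diag_sum A B) C = diag_sum A (diag_sum B C)"
  unfolding diag_sum_def by (rule assoc_four_block_mat[symmetric])

lemma diag_sum_mult:
  fixes A :: "'a::ring_1 mat"
  assumes "dim_col A = dim_row A'" "dim_col B = dim_row B'"
  shows "diag_sum A B * diag_sum A' B' = diag_sum (A * A') (B * B')"
proof -
  obtain ra ca rb cb where d: "A \<in> carrier_mat ra ca" "B \<in> carrier_mat rb cb"
    by (meson carrier_matI)
  moreover obtain sa sb where "A' \<in> carrier_mat ca sa" "B' \<in> carrier_mat cb sb"
    using assms d by (metis carrier_matD(2) carrier_matI)
  ultimately show ?thesis
    unfolding diag_sum_def
    by (subst mult_four_block_mat[where ?nr1.0 = ra and ?nr2.0 = rb and ?n1.0 = ca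
          and ?n2.0 = cb and ?nc1.0 = sa and ?nc2.0 = sb]) auto
qed

lemma diag_sum_comm_le:
  fixes A :: "'a::ring_1 mat"
  assumes "A \<in> rect_mats" "B \<in> rect_mats"
  shows "malc_le (diag_sum A B) (diag_sum B A)"
proof -
  obtain ra ca rb cb where d: "A \<in> carrier_mat ra ca" "B \<in> carrier_mat rb cb"
    by (meson carrier_matI)
  let ?P = "four_block_mat (0\<^sub>m ra rb) (1\<^sub>m ra) (1\<^sub>m rb) (0\<^sub>m rb ra) :: 'a mat"
  let ?Q = "four_block_mat (0\<^sub>m cb ca) (1\<^sub>m cb) (1\<^sub>m ca) (0\<^sub>m ca cb) :: 'a mat"
  have "?P * diag_sum B A = four_block_mat (0\<^sub>m ra cb) A B (0\<^sub>m rb ca)"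
    unfolding diag_sum_def
    by (subst mult_four_block_mat[where ?nr1.0 = ra and ?nr2.0 = rb and ?n1.0 = rb and ?n2.0 = ra
          and ?nc1.0 = cb and ?nc2.0 = ca]) (use d in auto)
  moreover have "four_block_mat (0\<^sub>m ra cb) A B (0\<^sub>m rb ca) * ?Q = diag_sum A B"
    unfolding diag_sum_def
    by (subst mult_four_block_mat[where ?nr1.0 = ra and ?nr2.0 = rb and ?n1.0 = cb and ?n2.0 = ca
          and ?nc1.0 = ca and ?nc2.0 = cb]) (use d in auto)
  ultimately have "?P * diag_sum B A * ?Q = diag_sum A B"
    by simp
  moreover have "malc_le (?P * diag_sum B A * ?Q) (diag_sum B A)"
    by (rule malc_le_prod) (use d assms in \<open>auto simp: rect_mats_def\<close>)
  ultimately show ?thesis by simp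
qed

lemma upper_block_diag_sum:
  assumes "F \<in> carrier_mat (dim_row C) (dim_col D)"
  shows "diag_sum (upper_block C F D) E = upper_block C
      (mat (dim_row C) (dim_col D + dim_col E) (\<lambda>(i, j). if j < dim_col D then F $$ (i, j) else 0))
      (diag_sum D E)"
  (is "?L = ?R")
proof (rule eq_matI)
  obtain a1 b1 a2 b2 a3 b3 where d: "dim_row C = a1" "dim_col C = b1" "dim_row D = a2"
      "dim_col D = b2" "dim_row E = a3" "dim_col E = b3" "dim_row F = a1" "dim_col F = b2"
    using assms by auto
  fix i j assume "i < dim_row ?R" "j < dim_col ?R"
  then have ij: "i < a1 + a2 + a3" "j < b1 + b2 + b3"
    using d by simp_all
  have i: "i < a1 \<or> (\<exists>i'. i = a1 + i' \<and> i' < a2) \<or> (\<exists>i'. i = a1 + a2 + i' \<and> i' < a3)"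
    using ij(1) by presburger
  have j: "j < b1 \<or> (\<exists>j'. j = b1 + j' \<and> j' < b2) \<or> (\<exists>j'. j = b1 + b2 + j' \<and> j' < b3)"
    using ij(2) by presburger
  show "?L $$ (i, j) = ?R $$ (i, j)"
    using i j by (elim disjE exE conjE; simp add: diag_sum_def upper_block_def d)
qed simp_all

lemma malc_step_diag_sum:
  fixes A :: "'a::ring_1 mat"
  assumes "malc_step A B" "E \<in> rect_mats"
  shows "malc_step (diag_sum A E) (diag_sum B E)"
  using assms(1)
proof cases
  case (prod C D)
  have "diag_sum A E = diag_sum C (1\<^sub>m (dim_row E)) * diag_sum B E * diag_sum D (1\<^sub>m (dim_col E))"
    using prod by (simp add: diag_sum_mult)
  moreover have "malc_step \<dots> (diag_sum B E)"
    by (rule malc_step.prod) (use prod assms(2) in \<open>auto simp: rect_mats_def\<close>)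
  ultimately show ?thesis by simp
next
  case (block C D F)
  let ?F = "mat (dim_row C) (dim_col D + dim_col E) (\<lambda>(i, j). if j < dim_col D then F $$ (i, j) else 0)"
  have "diag_sum A E = diag_sum C (diag_sum D E)"
    using block by (simp add: diag_sum_assoc)
  moreover have "diag_sum B E = upper_block C ?F (diag_sum D E)"
    using block upper_block_diag_sum by simp
  moreover have "malc_step (diag_sum C (diag_sum D E)) (upper_block C ?F (diag_sum D E))"
    by (rule malc_step.block) (use block assms(2) in \<open>auto simp: rect_mats_def\<close>)
  ultimately show ?thesis by simp
qed

lemma malc_le_diag_sum_left:
  assumes "malc_le A B" "E \<in> rect_mats"
  shows "malc_le (diag_sum A E) (diag_sum B E)"
proof -
  have "malc_step\<^sup>*\<^sup>* A B" using assms(1) by (simp add: malc_le_def)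
  then have "malc_step\<^sup>*\<^sup>* (diag_sum A E) (diag_sum B E)"
    by induction (auto intro: rtranclp.rtrancl_into_rtrancl malc_step_diag_sum[OF _ assms(2)])
  then show ?thesis using assms by (simp add: malc_le_def diag_sum_rect)
qed

lemma malc_le_diag_sum:
  assumes "malc_le A A'" "malc_le B B'"
  shows "malc_le (diag_sum A B) (diag_sum A' B')"
proof -
  have r: "A \<in> rect_mats" "A' \<in> rect_mats" "B \<in> rect_mats" "B' \<in> rect_mats"
    using assms by (auto simp: malc_le_def)
  have "malc_le (diag_sum A B) (diag_sum A' B)"
    by (rule malc_le_diag_sum_left[OF assms(1) r(3)])
  moreover have "malc_le (diag_sum A' B) (diag_sum B A')"
    by (rule diag_sum_comm_le[OF r(2,3)])
  moreover have "malc_le (diag_sum B A') (diag_sum B' A')"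
    by (rule malc_le_diag_sum_left[OF assms(2) r(2)])
  moreover have "malc_le (diag_sum B' A') (diag_sum A' B')"
    by (rule diag_sum_comm_le[OF r(4,2)])
  ultimately show ?thesis by (blast intro: malc_le_trans)
qed

lemma diag_sum_empty [simp]: "diag_sum (0\<^sub>m 0 0) A = A"
  by (rule eq_matI) (auto simp: diag_sum_def)

lemma malc_equiv_diag_zero:
  fixes A :: "'a::ring_1 mat"
  assumes "A \<in> rect_mats"
  shows "malc_equiv (diag_sum (elem_mat 0) A) A"
proof -
  let ?r = "1\<^sub>m (dim_row A) :: 'a mat" and ?c = "1\<^sub>m (dim_col A) :: 'a mat"
  have z: "elem_mat 0 = (0\<^sub>m 1 1 :: 'a mat)"
    by (rule eq_matI) (auto simp: elem_mat_def)
  have "diag_sum (0\<^sub>m 1 0) ?r * diag_sum (0\<^sub>m 0 0) A * diag_sum (0\<^sub>m 0 1) ?c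
      = diag_sum (elem_mat 0) A"
    by (simp add: diag_sum_mult z del: diag_sum_empty)
  moreover have "malc_le (diag_sum (0\<^sub>m 1 0) ?r * A * diag_sum (0\<^sub>m 0 1) ?c) A"
    by (rule malc_le_prod) (use assms in \<open>auto simp: rect_mats_def\<close>)
  moreover have "diag_sum (0\<^sub>m 0 1) ?r * diag_sum (elem_mat 0) A * diag_sum (0\<^sub>m 1 0) ?c = A"
    by (simp add: diag_sum_mult z)
  moreover have "malc_le (diag_sum (0\<^sub>m 0 1) ?r * diag_sum (elem_mat 0) A * diag_sum (0\<^sub>m 1 0) ?c)
      (diag_sum (elem_mat 0) A)"
    by (rule malc_le_prod) (use assms in \<open>auto simp: rect_mats_def elem_mat_def\<close>)
  ultimately show ?thesis by (simp add: malc_equiv_def)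
qed

text \<open>The type of classes of rectangular matrices; \<open>malc_class A\<close> is the class of \<open>A\<close>.
  For \<open>A\<close> outside \<open>rect_mats\<close> the value \<open>malc_class A\<close> carries no meaning.\<close>

quotient_type (overloaded) 'a malc_semigroup = "'a::ring_1 mat" / partial: malc_equiv
  morphisms malc_rep malc_class
proof (rule part_equivpI)
  show "\<exists>x :: 'a mat. malc_equiv x x"
    using malc_le_refl[OF elem_mat_rect] by (auto simp: malc_equiv_def)
  show "symp (malc_equiv :: 'a mat \<Rightarrow> _)"
    by (auto simp: malc_equiv_def intro: sympI)
  show "transp (malc_equiv :: 'a mat \<Rightarrow> _)"
    unfolding transp_def malc_equiv_def by (blast intro: malc_le_trans)
qed

instantiation malc_semigroup :: (ring_1) ordered_comm_monoid_add
begin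

lift_definition zero_malc_semigroup :: "'a malc_semigroup" is "elem_mat 0"
  by (simp add: malc_equiv_def malc_le_refl)

lift_definition plus_malc_semigroup ::
  "'a malc_semigroup \<Rightarrow> 'a malc_semigroup \<Rightarrow> 'a malc_semigroup" is diag_sum
  by (simp add: malc_equiv_def malc_le_diag_sum)

lift_definition less_eq_malc_semigroup ::
  "'a malc_semigroup \<Rightarrow> 'a malc_semigroup \<Rightarrow> bool" is malc_le
  unfolding malc_equiv_def by (blast intro: malc_le_trans)

definition less_malc_semigroup :: "'a malc_semigroup \<Rightarrow> 'a malc_semigroup \<Rightarrow> bool" where
  "less_malc_semigroup a b \<longleftrightarrow> a \<le> b \<and> \<not> b \<le> a"

instance
proof
  fix a b d :: "'a malc_semigroup"
  show "a + b + d = a + (b + d)"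
    by transfer (simp add: malc_equiv_refl_iff diag_sum_assoc diag_sum_rect)
  show "a + b = b + a"
    by transfer (simp only: malc_equiv_refl_iff malc_equiv_def[of "diag_sum a b" "diag_sum b a" for a b]
        diag_sum_comm_le simp_thms)
  show "0 + a = a"
    by transfer (simp only: malc_equiv_refl_iff malc_equiv_diag_zero)
  show "a < b \<longleftrightarrow> a \<le> b \<and> \<not> b \<le> a" by (rule less_malc_semigroup_def)
  show "a \<le> a" by transfer (simp add: malc_equiv_def)
  show "a \<le> b \<Longrightarrow> b \<le> d \<Longrightarrow> a \<le> d" by transfer (rule malc_le_trans)
  show "a \<le> b \<Longrightarrow> b \<le> a \<Longrightarrow> a = b" by transfer (simp add: malc_equiv_def)
  show "a \<le> b \<Longrightarrow> d + a \<le> d + b"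
    by transfer (simp add: malc_equiv_def malc_le_diag_sum)
qed

end

definition nat_multiple :: "nat \<Rightarrow> 'b::comm_monoid_add \<Rightarrow> 'b" where
  "nat_multiple m a = (\<Sum>_<m. a)"


section \<open>Sylvester matrix rank functions\<close>

text \<open>A rank function is a total function on the matrix type of which only the values on
  \<open>rect_mats\<close> matter.\<close>

definition sylvester_rank_functions :: "('a::ring_1 mat \<Rightarrow> real) set" where
  "sylvester_rank_functions = {rk.
     (\<forall>A\<in>rect_mats. 0 \<le> rk A)
   \<and> (\<forall>r>0. \<forall>s>0. rk (0\<^sub>m r s) = 0) \<and> rk (elem_mat 1) = 1
   \<and> (\<forall>A\<in>rect_mats. \<forall>B\<in>rect_mats. dim_col A = dim_row B \<longrightarrow> rk (A * B) \<le> min (rk A) (rk B))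
   \<and> (\<forall>A\<in>rect_mats. \<forall>B\<in>rect_mats. rk (diag_sum A B) = rk A + rk B)
   \<and> (\<forall>A\<in>rect_mats. \<forall>B\<in>rect_mats. \<forall>C\<in>carrier_mat (dim_row A) (dim_col B).
        rk (upper_block A C B) \<ge> rk A + rk B)}"

definition class_rank :: "('a::ring_1 mat \<Rightarrow> real) \<Rightarrow> 'a malc_semigroup \<Rightarrow> real" where
  "class_rank rk a = rk (SOME A. A \<in> rect_mats \<and> malc_class A = a)"

lemma sylvester_rank_mono:
  assumes rk: "rk \<in> sylvester_rank_functions" and "malc_le A B"
  shows "rk A \<le> rk B"
proof -
  have step: "rk X \<le> rk Y" if "malc_step X Y" for X Y
    using that
  proof cases
    case (prod C D)
    have "C * Y \<in> rect_mats" using prod by (simp add: rect_mats_def)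
    then have "rk (C * Y * D) \<le> rk (C * Y)"
      using rk prod by (auto simp: sylvester_rank_functions_def)
    also have "\<dots> \<le> rk Y"
      using rk prod by (auto simp: sylvester_rank_functions_def)
    finally show ?thesis using prod by simp
  next
    case (block C D E)
    then show ?thesis using rk by (auto simp: sylvester_rank_functions_def)
  qed
  have "malc_step\<^sup>*\<^sup>* A B" using assms(2) by (simp add: malc_le_def)
  then show ?thesis by induction (auto dest: step)
qed

lemma malc_class_eq_iff:
  assumes "A \<in> rect_mats" "B \<in> rect_mats"
  shows "malc_class A = malc_class B \<longleftrightarrow> malc_equiv A B"
  using Quotient_rel[OF Quotient_malc_semigroup, of A B] assms
  by (auto simp: malc_equiv_def malc_le_refl)

lemma class_rank_malc_class:
  assumes "rk \<in> sylvester_rank_functions" "A \<in> rect_mats"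
  shows "class_rank rk (malc_class A) = rk A"
proof -
  let ?B = "SOME B. B \<in> rect_mats \<and> malc_class B = malc_class A"
  have "?B \<in> rect_mats \<and> malc_class ?B = malc_class A"
    by (rule someI[of _ A]) (simp add: assms)
  then have "malc_equiv ?B A" using assms(2) malc_class_eq_iff by blast
  then show ?thesis
    unfolding class_rank_def malc_equiv_def using sylvester_rank_mono[OF assms(1)]
    by (simp add: antisym)
qed

text \<open>The function \<open>rk\<^sub>k\<close> is singled out by its values on the powers of \<open>c\<close>. It is determined only
  on \<open>rect_mats\<close>, and not on matrices without rows or columns, so it is chosen by \<open>SOME\<close>
  instead of \<open>THE\<close>. Its existence is not assumed anywhere.\<close>

definition is_rank_k :: "'a::ring_1 \<Rightarrow> nat \<Rightarrow> nat \<Rightarrow> ('a mat \<Rightarrow> real) \<Rightarrow> bool" where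
  "is_rank_k c n k rk \<longleftrightarrow> rk \<in> sylvester_rank_functions
     \<and> (\<forall>i<k. rk (elem_mat (c ^ i)) = (real k - real i) / real k)
     \<and> (\<forall>i. k \<le> i \<and> i < n \<longrightarrow> rk (elem_mat (c ^ i)) = 0)"

definition rank_k :: "'a::ring_1 \<Rightarrow> nat \<Rightarrow> nat \<Rightarrow> 'a mat \<Rightarrow> real" where
  "rank_k c n k = (SOME rk. is_rank_k c n k rk)"

end

theory Submission
  imports Defs "HOL-Library.Function_Algebras"
begin

text \<open>Every element of the ring is \<open>0\<close> or a unit times a power of the central element \<open>c\<close>, so pivoting on
  an entry with minimal exponent writes each class as a sum of classes of powers of \<open>c\<close>.
  The rank function \<open>rk\<^sub>k\<close> is \<open>1/k\<close> times the length of the row space over \<open>R / c\<^sup>k R\<close>; on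
  \<open>\<Sum> m\<^sub>i \<langle>c\<^sup>i\<rangle>\<close> it equals \<open>1/k\<close> times \<open>\<Sum> m\<^sub>i max (k - i) 0\<close>, and these numbers for \<open>k = 1, \<dots>, n\<close>
  determine the \<open>m\<^sub>i\<close>.
  Conversely, \<open>\<langle>c\<^sup>i\<rangle> + \<langle>c\<^sup>j\<rangle> \<le> \<langle>c\<^sup>i\<^sup>-\<^sup>1\<rangle> + \<langle>c\<^sup>j\<^sup>+\<^sup>1\<rangle>\<close> for \<open>1 \<le> i \<le> j\<close>, which increases the \<open>k\<close>-th number
  by one exactly for \<open>i \<le> k \<le> j\<close>. If the numbers of one sum are dominated by those of another, such
  exchanges lead from the first sum to the second.\<close>

section \<open>Chains of submodules\<close>

text \<open>All vectors live in one ambient module of infinite sequences, so that matrices of every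
  size act on the same module.\<close>

definition left_submodule :: "(nat \<Rightarrow> 'a::ring_1) set \<Rightarrow> bool" where
  "left_submodule M \<longleftrightarrow> 0 \<in> M \<and> (\<forall>x\<in>M. \<forall>y\<in>M. x + y \<in> M) \<and> (\<forall>r. \<forall>x\<in>M. (\<lambda>i. r * x i) \<in> M)"

definition linear_map :: "((nat \<Rightarrow> 'a::ring_1) \<Rightarrow> nat \<Rightarrow> 'a) \<Rightarrow> bool" where
  "linear_map f \<longleftrightarrow> (\<forall>x y. f (x + y) = f x + f y) \<and> (\<forall>r x. f (\<lambda>i. r * x i) = (\<lambda>i. r * f x i))"

definition sum_mod :: "(nat \<Rightarrow> 'a::ring_1) set \<Rightarrow> (nat \<Rightarrow> 'a) set \<Rightarrow> (nat \<Rightarrow> 'a) set" where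
  "sum_mod M N = {x + y | x y. x \<in> M \<and> y \<in> N}"

lemma left_submodule_zero: "left_submodule M \<Longrightarrow> 0 \<in> M"
  and left_submodule_add: "left_submodule M \<Longrightarrow> x \<in> M \<Longrightarrow> y \<in> M \<Longrightarrow> x + y \<in> M"
  and left_submodule_scale: "left_submodule M \<Longrightarrow> x \<in> M \<Longrightarrow> (\<lambda>i. r * x i) \<in> M"
  by (auto simp: left_submodule_def)

lemma left_submodule_diff:
  assumes "left_submodule M" "x \<in> M" "y \<in> M"
  shows "x - y \<in> M"
proof -
  have "x - y = x + (\<lambda>i. - 1 * y i)" by (auto simp: fun_eq_iff)
  then show ?thesis using left_submodule_add left_submodule_scale assms by metis
qed

lemma left_submodule_Int: "left_submodule M \<Longrightarrow> left_submodule N \<Longrightarrow> left_submodule (M \<inter> N)"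
  by (auto simp: left_submodule_def)

lemma left_submodule_vimage:
  assumes "linear_map f" "left_submodule M"
  shows "left_submodule (f -` M)"
proof -
  have "f 0 = 0"
    using assms(1) unfolding linear_map_def by (metis add_cancel_left_left)
  then show ?thesis using assms by (auto simp: left_submodule_def linear_map_def)
qed

lemma left_submodule_image:
  assumes "linear_map f" "left_submodule M"
  shows "left_submodule (f ` M)"
proof -
  have "f 0 = 0"
    using assms(1) unfolding linear_map_def by (metis add_cancel_left_left)
  moreover have "f x + f y \<in> f ` M" if "x \<in> M" "y \<in> M" for x y
    using assms that unfolding left_submodule_def linear_map_def by (metis imageI)
  moreover have "(\<lambda>i. r * f x i) \<in> f ` M" if "x \<in> M" for r x
    using assms that unfolding left_submodule_def linear_map_def by (metis imageI)
  ultimately show ?thesis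
    using left_submodule_zero[OF assms(2)] unfolding left_submodule_def by force
qed

lemma sum_modI: "x \<in> M \<Longrightarrow> y \<in> N \<Longrightarrow> x + y \<in> sum_mod M N"
  by (auto simp: sum_mod_def)

lemma left_submodule_sum_mod:
  assumes M: "left_submodule M" and N: "left_submodule N"
  shows "left_submodule (sum_mod M N)"
  unfolding left_submodule_def
proof (intro conjI ballI allI)
  show "0 \<in> sum_mod M N"
    using sum_modI[OF left_submodule_zero[OF M] left_submodule_zero[OF N]] by simp
next
  fix x y assume "x \<in> sum_mod M N" "y \<in> sum_mod M N"
  then obtain a b a' b' where "x = a + b" "y = a' + b'" "a \<in> M" "b \<in> N" "a' \<in> M" "b' \<in> N"
    by (auto simp: sum_mod_def)
  moreover have "a + b + (a' + b') = (a + a') + (b + b')" by (simp add: algebra_simps)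
  ultimately show "x + y \<in> sum_mod M N"
    using sum_modI left_submodule_add M N by metis
next
  fix r x assume "x \<in> sum_mod M N"
  then obtain a b where "x = a + b" "a \<in> M" "b \<in> N" by (auto simp: sum_mod_def)
  moreover have "(\<lambda>i. r * (a + b) i) = (\<lambda>i. r * a i) + (\<lambda>i. r * b i)"
    by (auto simp: fun_eq_iff distrib_left)
  ultimately show "(\<lambda>i. r * x i) \<in> sum_mod M N"
    using sum_modI left_submodule_scale M N by metis
qed

lemma sum_mod_mono: "M \<subseteq> M' \<Longrightarrow> N \<subseteq> N' \<Longrightarrow> sum_mod M N \<subseteq> sum_mod M' N'"
  by (auto simp: sum_mod_def)

lemma sum_mod_upper1: "left_submodule N \<Longrightarrow> M \<subseteq> sum_mod M N"
  using sum_modI[of _ M 0 N] by (auto simp: left_submodule_zero)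

lemma sum_mod_upper2: "left_submodule M \<Longrightarrow> N \<subseteq> sum_mod M N"
  using sum_modI[of 0 M _ N] by (auto simp: left_submodule_zero)

text \<open>The first term only has to contain \<open>M\<close>, so the same terms serve for every
  smaller \<open>M\<close>; \<open>N\<close> is the last term.\<close>

inductive chain :: "(nat \<Rightarrow> 'a::ring_1) set \<Rightarrow> (nat \<Rightarrow> 'a) set \<Rightarrow> nat \<Rightarrow> bool" for M where
  base: "left_submodule N \<Longrightarrow> M \<subseteq> N \<Longrightarrow> chain M N 0"
| step: "chain M N l \<Longrightarrow> left_submodule P \<Longrightarrow> N \<subset> P \<Longrightarrow> chain M P (Suc l)"

lemma chain_subset: "chain M N l \<Longrightarrow> M \<subseteq> N"
  by (induction rule: chain.induct) auto

lemma chain_left_submodule: "chain M N l \<Longrightarrow> left_submodule N"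
  by (induction rule: chain.induct) auto

lemma chain_extend_top:
  assumes "chain M N l" "left_submodule P" "N \<subseteq> P"
  shows "chain M P l"
  using assms(1)
proof cases
  case base
  then show ?thesis using assms by (auto intro: chain.base)
next
  case (step N' l')
  then have "N' \<subset> P" using assms(3) by blast
  then show ?thesis using step(1,2) assms(2) by (simp add: chain.step)
qed

text \<open>The first term of the upper chain contains \<open>P\<close>, hence \<open>N\<close>. It
  replaces the last term of the lower chain, so the lengths add up.\<close>

lemma chain_concat:
  assumes "chain P Q b" "chain M N a" "N \<subseteq> P"
  shows "chain M Q (a + b)"
  using assms(1)
proof induction
  case (base N')
  then show ?case using chain_extend_top[OF assms(2)] assms(3) by fastforce
next
  case (step N' l P')
  then show ?case by (auto intro: chain.step)
qed

lemma chain_antimono: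
  assumes "chain M N l" "M' \<subseteq> M"
  shows "chain M' N l"
  using assms(1) by induction (use assms(2) in \<open>auto intro: chain.intros\<close>)

lemma chain_map:
  assumes "chain M N l"
    and "\<And>X. left_submodule X \<Longrightarrow> M \<subseteq> X \<Longrightarrow> left_submodule (g X) \<and> M' \<subseteq> g X"
    and "\<And>X Y. left_submodule X \<Longrightarrow> left_submodule Y \<Longrightarrow> M \<subseteq> X \<Longrightarrow> X \<subset> Y \<Longrightarrow> g X \<subset> g Y"
  shows "chain M' (g N) l"
  using assms(1)
proof induction
  case (base N)
  then show ?case using assms(2) by (simp add: chain.base)
next
  case (step N l P)
  have "M \<subseteq> N" "left_submodule N"
    using chain_subset[OF step.hyps(1)] chain_left_submodule[OF step.hyps(1)] by auto
  then have "left_submodule (g P)" "g N \<subset> g P"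
    using assms(2)[OF step.hyps(2)] assms(3)[OF _ step.hyps(2) _ step.hyps(3)] step.hyps(3) by auto
  with step.IH show ?case by (rule chain.step)
qed

text \<open>The map that \<open>f\<close> induces from the quotient by the preimage of
  \<open>M\<close> to the quotient by \<open>M\<close> is injective, so distinct submodules above
  the preimage keep distinct images modulo \<open>M\<close>.\<close>

lemma chain_vimage:
  assumes f: "linear_map f" and M: "left_submodule M" and ch: "chain (f -` M) N l"
  shows "chain M (sum_mod (f ` N) M) l"
proof (rule chain_map[OF ch])
  fix X assume X: "left_submodule X" "f -` M \<subseteq> X"
  show "left_submodule (sum_mod (f ` X) M) \<and> M \<subseteq> sum_mod (f ` X) M"
    using left_submodule_sum_mod[OF left_submodule_image[OF f X(1)] M]
      sum_mod_upper2[OF left_submodule_image[OF f X(1)]] by simp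
next
  fix X Y assume X: "left_submodule X" "left_submodule Y" "f -` M \<subseteq> X" "X \<subset> Y"
  then obtain y where y: "y \<in> Y" "y \<notin> X" by blast
  have "f y \<in> sum_mod (f ` Y) M"
    using y sum_mod_upper1[OF M] by blast
  moreover have "f y \<notin> sum_mod (f ` X) M"
  proof
    assume "f y \<in> sum_mod (f ` X) M"
    then obtain x m where xm: "x \<in> X" "m \<in> M" "f y = f x + m" by (auto simp: sum_mod_def)
    have "f (y - x) + f x = f y"
      using f unfolding linear_map_def by (metis diff_add_cancel)
    then have "f (y - x) = m" using xm(3) by (simp add: algebra_simps)
    then have "y - x \<in> X" using xm X(3) by blast
    then have "y - x + x \<in> X" using left_submodule_add X(1) xm(1) by blast
    then show False using y by simp
  qed
  moreover have "sum_mod (f ` X) M \<subseteq> sum_mod (f ` Y) M"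
    using X(4) by (intro sum_mod_mono) auto
  ultimately show "sum_mod (f ` X) M \<subset> sum_mod (f ` Y) M" by blast
qed

text \<open>By the modular law a strict inclusion above \<open>M \<inter> N\<close> stays strict after adding \<open>M\<close>, or after
  intersecting with \<open>M\<close> and adding \<open>N\<close>.\<close>

lemma chain_Int:
  assumes M: "left_submodule M" and N: "left_submodule N" and ch: "chain (M \<inter> N) P l"
  shows "\<exists>a b. l \<le> a + b \<and> chain M (sum_mod P M) a \<and> chain N (sum_mod (P \<inter> M) N) b"
  using ch
proof induction
  case (base P)
  have "chain M (sum_mod P M) 0"
    by (rule chain.base[OF left_submodule_sum_mod[OF base(1) M] sum_mod_upper2[OF base(1)]])
  moreover have PM: "left_submodule (P \<inter> M)"
    by (rule left_submodule_Int[OF base(1) M])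
  have "chain N (sum_mod (P \<inter> M) N) 0"
    by (rule chain.base[OF left_submodule_sum_mod[OF PM N] sum_mod_upper2[OF PM]])
  ultimately show ?case by (intro exI[of _ 0]) simp
next
  case (step X l Y)
  then obtain a b where ab: "l \<le> a + b" "chain M (sum_mod X M) a" "chain N (sum_mod (X \<inter> M) N) b"
    by blast
  have X: "left_submodule X" "M \<inter> N \<subseteq> X"
    using chain_subset[OF step.hyps(1)] chain_left_submodule[OF step.hyps(1)] by auto
  have sY: "left_submodule (sum_mod Y M)" "left_submodule (sum_mod (Y \<inter> M) N)"
    using step.hyps M N by (auto intro: left_submodule_sum_mod left_submodule_Int)
  have sub: "sum_mod X M \<subseteq> sum_mod Y M" "sum_mod (X \<inter> M) N \<subseteq> sum_mod (Y \<inter> M) N"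
    using step.hyps(3) sum_mod_mono[of X Y M M] sum_mod_mono[of "X \<inter> M" "Y \<inter> M" N N] by auto
  show ?case
  proof (cases "sum_mod X M = sum_mod Y M \<and> sum_mod (X \<inter> M) N = sum_mod (Y \<inter> M) N")
    case True
    \<comment> \<open>If neither sum grew, \<open>y\<close> would split as
      \<open>x + x' + m'\<close> with \<open>m'\<close> in \<open>M \<inter> N\<close>, and all
      three summands lie in \<open>X\<close>.\<close>
    obtain y where y: "y \<in> Y" "y \<notin> X" using step.hyps by blast
    have "y \<in> sum_mod X M" using y True sum_mod_upper1[OF M] by blast
    then obtain x m where xm: "x \<in> X" "m \<in> M" "y = x + m" by (auto simp: sum_mod_def)
    have "m = y - x" using xm by simp
    moreover have "x \<in> Y" using xm step.hyps by blast
    ultimately have "m \<in> Y \<inter> M" using xm y left_submodule_diff[OF step.hyps(2)] by blast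
    then have "m \<in> sum_mod (X \<inter> M) N" using True sum_mod_upper1[OF N] by blast
    then obtain x' m' where xm': "x' \<in> X" "x' \<in> M" "m' \<in> N" "m = x' + m'"
      by (auto simp: sum_mod_def)
    have "m' = m - x'" using xm' by simp
    then have "m' \<in> M" using left_submodule_diff[OF M] xm xm' by blast
    then have "m' \<in> X" using xm' X by blast
    then have "y \<in> X" using xm xm' left_submodule_add[OF X(1)] by blast
    then show ?thesis using y by simp
  next
    case False
    then consider "sum_mod X M \<subset> sum_mod Y M" | "sum_mod (X \<inter> M) N \<subset> sum_mod (Y \<inter> M) N"
      using sub by blast
    then show ?thesis
    proof cases
      case 1
      have "chain M (sum_mod Y M) (Suc a)" "chain N (sum_mod (Y \<inter> M) N) b"
        using chain.step[OF ab(2) sY(1) 1] chain_extend_top[OF ab(3) sY(2) sub(2)] by simp_all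
      then show ?thesis using ab(1) by (metis Suc_le_mono add_Suc)
    next
      case 2
      have "chain M (sum_mod Y M) a" "chain N (sum_mod (Y \<inter> M) N) (Suc b)"
        using chain.step[OF ab(3) sY(2) 2] chain_extend_top[OF ab(2) sY(1) sub(1)] by simp_all
      then show ?thesis using ab(1) by (metis Suc_le_mono add_Suc_right)
    qed
  qed
qed

section \<open>Length of the quotient by a submodule\<close>

definition finite_colength :: "(nat \<Rightarrow> 'a::ring_1) set \<Rightarrow> bool" where
  "finite_colength M \<longleftrightarrow> (\<exists>b. \<forall>N l. chain M N l \<longrightarrow> l \<le> b)"

text \<open>For a submodule \<open>M\<close> this is the length of the quotient module. Without a
  bound on the chain lengths \<open>GREATEST\<close> says nothing, hence the separate predicate
  \<open>finite_colength\<close>.\<close>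

definition colength :: "(nat \<Rightarrow> 'a::ring_1) set \<Rightarrow> nat" where
  "colength M = (GREATEST l. \<exists>N. chain M N l)"

lemma left_submodule_UNIV [simp]: "left_submodule UNIV"
  by (simp add: left_submodule_def)

lemma colength_attained:
  assumes "finite_colength M"
  shows "\<exists>N. chain M N (colength M)"
proof -
  obtain b where b: "\<And>N l. chain M N l \<Longrightarrow> l \<le> b"
    using assms by (auto simp: finite_colength_def)
  have "\<exists>N. chain M N 0" using chain.base[of UNIV M] by auto
  then show ?thesis
    unfolding colength_def by (rule GreatestI_nat[where b = b]) (auto dest: b)
qed

lemma colength_ge:
  assumes "finite_colength M" "chain M N l"
  shows "l \<le> colength M"
proof -
  obtain b where b: "\<And>N l. chain M N l \<Longrightarrow> l \<le> b"
    using assms by (auto simp: finite_colength_def)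
  show ?thesis
    unfolding colength_def
    by (rule Greatest_le_nat[where b = b]) (use assms(2) in \<open>auto dest: b\<close>)
qed

lemma colength_vimage:
  assumes "linear_map f" "left_submodule M" "finite_colength M"
  shows "finite_colength (f -` M)" "colength (f -` M) \<le> colength M"
proof -
  have *: "l \<le> colength M" if "chain (f -` M) N l" for N l
    using colength_ge[OF assms(3) chain_vimage[OF assms(1,2) that]]  .
  then show "finite_colength (f -` M)" by (auto simp: finite_colength_def)
  then show "colength (f -` M) \<le> colength M" using * by (blast dest: colength_attained)
qed

text \<open>The quotient by an intersection embeds into the direct sum of the two quotients.\<close>

lemma colength_Int:
  assumes "left_submodule M" "left_submodule N" "finite_colength M" "finite_colength N"
  shows "finite_colength (M \<inter> N)" "colength (M \<inter> N) \<le> colength M + colength N"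
proof -
  have *: "l \<le> colength M + colength N" if "chain (M \<inter> N) P l" for P l
    using chain_Int[OF assms(1,2) that] colength_ge[OF assms(3)] colength_ge[OF assms(4)]
    by fastforce
  then show "finite_colength (M \<inter> N)" by (auto simp: finite_colength_def)
  then show "colength (M \<inter> N) \<le> colength M + colength N" using * by (blast dest: colength_attained)
qed

lemma colength_antimono:
  assumes "M' \<subseteq> M" "finite_colength M'"
  shows "finite_colength M" "colength M \<le> colength M'"
proof -
  have *: "l \<le> colength M'" if "chain M N l" for N l
    using colength_ge[OF assms(2) chain_antimono[OF that assms(1)]] .
  then show "finite_colength M" by (auto simp: finite_colength_def)
  then show "colength M \<le> colength M'" using * by (blast dest: colength_attained)
qed

lemma colength_UNIV: "finite_colength (UNIV :: (nat \<Rightarrow> 'a::ring_1) set)"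
  "colength (UNIV :: (nat \<Rightarrow> 'a::ring_1) set) = 0"
proof -
  have *: "l = 0" if "chain (UNIV :: (nat \<Rightarrow> 'a) set) N l" for N l
    using that
  proof cases
    case (step N' l')
    then show ?thesis using chain_subset[OF step(2)] by blast
  qed simp
  then show "finite_colength (UNIV :: (nat \<Rightarrow> 'a) set)" by (auto simp: finite_colength_def)
  then show "colength (UNIV :: (nat \<Rightarrow> 'a) set) = 0" using * by (blast dest: colength_attained)
qed

section \<open>The rank functions\<close>

text \<open>Row vectors multiply from the left, which keeps the map linear for left scalars over a
  noncommutative ring.\<close>

definition row_act :: "'a::ring_1 mat \<Rightarrow> (nat \<Rightarrow> 'a) \<Rightarrow> nat \<Rightarrow> 'a" where
  "row_act A x j = (if j < dim_col A then \<Sum>i<dim_row A. x i * A $$ (i, j) else 0)"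

lemma linear_row_act: "linear_map (row_act A)"
  by (auto simp: linear_map_def row_act_def fun_eq_iff distrib_right sum.distrib sum_distrib_left
      mult.assoc)

lemma row_act_mult:
  assumes "dim_col A = dim_row B"
  shows "row_act (A * B) x = row_act B (row_act A x)"
proof
  fix j
  show "row_act (A * B) x j = row_act B (row_act A x) j"
  proof (cases "j < dim_col B")
    case True
    have "row_act (A * B) x j = (\<Sum>i<dim_row A. \<Sum>l<dim_row B. x i * (A $$ (i, l) * B $$ (l, j)))"
      using True assms
      by (simp add: row_act_def scalar_prod_def sum_distrib_left lessThan_atLeast0)
    also have "\<dots> = (\<Sum>l<dim_row B. \<Sum>i<dim_row A. x i * (A $$ (i, l) * B $$ (l, j)))"
      by (rule sum.swap)
    also have "\<dots> = row_act B (row_act A x) j"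
      using True assms by (simp add: row_act_def sum_distrib_right mult.assoc)
    finally show ?thesis .
  qed (simp add: row_act_def)
qed

lemma sum_lessThan_add:
  fixes f :: "nat \<Rightarrow> 'b::comm_monoid_add"
  shows "(\<Sum>i<a + b. f i) = (\<Sum>i<a. f i) + (\<Sum>i<b. f (a + i))"
  by (induction b) (auto simp: add.assoc)

lemma row_act_upper_block:
  assumes "E \<in> carrier_mat (dim_row A) (dim_col B)"
  shows "row_act (upper_block A E B) x j =
    (if j < dim_col A then row_act A x j
     else row_act E x (j - dim_col A) + row_act B (\<lambda>i. x (dim_row A + i)) (j - dim_col A))"
  using assms by (auto simp: row_act_def sum_lessThan_add upper_block_def)

lemma diag_sum_upper_block:
  "diag_sum A B = upper_block A (0\<^sub>m (dim_row A) (dim_col B)) B"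
  by (simp add: diag_sum_def upper_block_def)

lemma row_act_zero_mat [simp]: "row_act (0\<^sub>m r s) x j = 0"
  by (simp add: row_act_def)

text \<open>The properties of the ring on which the computation rests;
  \<open>chain_ring_of_local_artinian\<close> derives them from the hypotheses of the
  theorem.\<close>

locale chain_ring =
  fixes c :: "'a::ring_1" and n :: nat
  assumes central: "c * x = x * c"
    and pow_n: "c ^ n = 0"
    and pow_nz: "i < n \<Longrightarrow> c ^ i \<noteq> 0"
    and unit_pow: "x \<noteq> 0 \<Longrightarrow> \<exists>u\<in>invertible_elements. \<exists>i<n. x = u * c ^ i"
begin

section \<open>Ideals generated by powers of \<open>c\<close>\<close>

lemma pow_central: "c ^ k * x = x * c ^ k"
  by (induction k) (auto simp: mult.assoc central, metis central mult.assoc)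

lemma pow_eq_0: "n \<le> i \<Longrightarrow> c ^ i = 0"
  using pow_n by (metis le_add_diff_inverse mult_zero_left power_add)

definition pow_ideal :: "nat \<Rightarrow> 'a set" where
  "pow_ideal k = range (\<lambda>y. y * c ^ k)"

lemma pow_ideal_zero [simp]: "0 \<in> pow_ideal k"
  unfolding pow_ideal_def by (rule image_eqI[of _ _ 0]) auto

lemma pow_ideal_add: "x \<in> pow_ideal k \<Longrightarrow> y \<in> pow_ideal k \<Longrightarrow> x + y \<in> pow_ideal k"
  unfolding pow_ideal_def by (auto simp: distrib_right[symmetric])

lemma pow_ideal_mult_left: "x \<in> pow_ideal k \<Longrightarrow> r * x \<in> pow_ideal k"
  unfolding pow_ideal_def by (auto simp: mult.assoc[symmetric])

lemma pow_ideal_mult_right: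
  assumes "x \<in> pow_ideal k"
  shows "x * r \<in> pow_ideal k"
proof -
  obtain y where "x = y * c ^ k" using assms by (auto simp: pow_ideal_def)
  then have "x * r = (y * r) * c ^ k" by (simp add: mult.assoc pow_central)
  then show ?thesis by (auto simp: pow_ideal_def)
qed

lemma pow_ideal_sum: "(\<And>i. i \<in> I \<Longrightarrow> f i \<in> pow_ideal k) \<Longrightarrow> sum f I \<in> pow_ideal k"
  by (induction I rule: infinite_finite_induct) (auto intro: pow_ideal_add)

text \<open>Otherwise \<open>c ^ a\<close> is a multiple of a higher power. Substituting this
  relation into itself raises the exponent without bound, so \<open>c ^ a\<close> would be
  0.\<close>

lemma pow_mem_pow_ideal:
  assumes "c ^ a \<in> pow_ideal b" "a < n"
  shows "b \<le> a"
proof (rule ccontr)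
  assume "\<not> b \<le> a"
  then obtain d where b: "b = a + Suc d" by (metis add_Suc_right less_imp_Suc_add not_le)
  obtain z where z: "c ^ a = z * c ^ (a + Suc d)" using assms(1) b by (auto simp: pow_ideal_def)
  have "\<exists>w. c ^ a = w * c ^ (a + m)" for m
  proof (induction m)
    case 0
    show ?case by (rule exI[of _ 1]) simp
  next
    case (Suc m)
    then obtain w where "c ^ a = w * c ^ m * c ^ a"
      by (auto simp: mult.assoc add.commute simp flip: power_add)
    also have "\<dots> = w * (c ^ m * z) * c ^ (a + Suc d)"
      using z by (metis mult.assoc)
    also have "\<dots> = w * z * c ^ (m + (a + Suc d))"
      by (simp only: pow_central[of m z] mult.assoc power_add)
    also have "m + (a + Suc d) = d + (a + Suc m)" by simp
    also have "w * z * c ^ \<dots> = w * z * c ^ d * c ^ (a + Suc m)"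
      by (simp only: mult.assoc power_add)
    finally show ?case by blast
  qed
  then obtain w where "c ^ a = w * c ^ (a + n)" by blast
  then show False using pow_eq_0[of "a + n"] pow_nz[OF assms(2)] by simp
qed

lemma pow_ideal_cancel:
  assumes "x * c ^ i \<in> pow_ideal k" "k \<le> n"
  shows "x \<in> pow_ideal (k - i)"
proof (cases "x = 0")
  case False
  then obtain u m where u: "u \<in> invertible_elements" "m < n" "x = u * c ^ m"
    using unit_pow by blast
  then obtain v where v: "v * u = 1" by (auto simp: invertible_elements_def)
  have "v * (x * c ^ i) = c ^ (m + i)"
    by (simp add: u power_add mult.assoc[symmetric] v)
  then have *: "c ^ (m + i) \<in> pow_ideal k" using pow_ideal_mult_left assms(1) by metis
  \<comment> \<open>If \<open>m + i \<ge> n\<close>, the power is 0 and its membership says nothing;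
    then \<open>k \<le> n\<close> gives the bound.\<close>
  have "k - i \<le> m"
  proof (cases "m + i < n")
    case True
    then show ?thesis using pow_mem_pow_ideal[OF *] by simp
  qed (use assms(2) in simp)
  then have "x = u * c ^ (m - (k - i)) * c ^ (k - i)"
    by (simp add: u mult.assoc flip: power_add)
  then show ?thesis by (auto simp: pow_ideal_def)
qed simp

definition ideal_vecs :: "nat \<Rightarrow> (nat \<Rightarrow> 'a) set" where
  "ideal_vecs k = {x. \<forall>j. x j \<in> pow_ideal k}"

text \<open>The quotient of the free module by \<open>kernel k A\<close> is the row space of \<open>A\<close> modulo \<open>c ^ k\<close>, so
  the colength of \<open>kernel k A\<close> is the length of that row space. All vectors are sequences, with the
  entries beyond the number of rows or columns ignored.\<close>

definition kernel :: "nat \<Rightarrow> 'a mat \<Rightarrow> (nat \<Rightarrow> 'a) set" where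
  "kernel k A = row_act A -` ideal_vecs k"

text \<open>The quotient of the sequence module by this set is the ring modulo the ideal of
  \<open>c ^ k\<close>.\<close>

definition first_in :: "nat \<Rightarrow> (nat \<Rightarrow> 'a) set" where
  "first_in k = {x. x 0 \<in> pow_ideal k}"

lemma left_submodule_ideal_vecs: "left_submodule (ideal_vecs k)"
  by (auto simp: left_submodule_def ideal_vecs_def pow_ideal_add pow_ideal_mult_left)

lemma left_submodule_first_in: "left_submodule (first_in k)"
  by (auto simp: left_submodule_def first_in_def pow_ideal_add pow_ideal_mult_left)

lemma left_submodule_kernel: "left_submodule (kernel k A)"
  unfolding kernel_def by (rule left_submodule_vimage[OF linear_row_act left_submodule_ideal_vecs])

lemma row_act_ideal_vecs: "x \<in> ideal_vecs k \<Longrightarrow> row_act A x \<in> ideal_vecs k"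
  by (auto simp: ideal_vecs_def row_act_def intro!: pow_ideal_sum pow_ideal_mult_right)

text \<open>Such an \<open>X\<close> depends only on the first coordinates of its elements, and
  these form a left ideal. Nonzero ring elements are units times powers of \<open>c\<close>, so this
  left ideal is generated by a power of \<open>c\<close>.\<close>

lemma left_submodule_eq_first_in:
  assumes X: "left_submodule X" "first_in j \<subseteq> X"
  shows "X = first_in (LEAST m. first_in m \<subseteq> X)"
proof
  let ?v = "LEAST m. first_in m \<subseteq> X"
  show "first_in ?v \<subseteq> X" using assms(2) by (rule LeastI)
  show "X \<subseteq> first_in ?v"
  proof
    fix x assume x: "x \<in> X"
    show "x \<in> first_in ?v"
    proof (cases "x 0 = 0")
      case False
      then obtain u m where u: "u \<in> invertible_elements" "x 0 = u * c ^ m"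
        using unit_pow by blast
      then obtain v where v: "v * u = 1" by (auto simp: invertible_elements_def)
      have "first_in m \<subseteq> X"
      proof
        fix y assume "y \<in> first_in m"
        then obtain a where a: "y 0 = a * c ^ m" by (auto simp: first_in_def pow_ideal_def)
        have "a * (v * (u * c ^ m)) = a * c ^ m"
          using v by (simp add: mult.assoc[symmetric, of v])
        then have "y - (\<lambda>i. a * (v * x i)) \<in> first_in j"
          by (simp add: first_in_def a u)
        moreover have "(\<lambda>i. a * (v * x i)) \<in> X"
          using left_submodule_scale[OF X(1)] x by blast
        ultimately have "y - (\<lambda>i. a * (v * x i)) + (\<lambda>i. a * (v * x i)) \<in> X"
          using X left_submodule_add by blast
        then show "y \<in> X" by simp
      qed
      then have "?v \<le> m" by (rule Least_le)
      then have "x 0 = u * c ^ (m - ?v) * c ^ ?v"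
        by (simp add: u mult.assoc flip: power_add)
      then show ?thesis by (auto simp: first_in_def pow_ideal_def)
    qed (simp add: first_in_def)
  qed
qed

text \<open>Each strict inclusion lowers the least exponent by at least one, and at the bottom it is
  at most \<open>j\<close>.\<close>

lemma chain_first_in_le:
  assumes "chain (first_in j) N l"
  shows "l + (LEAST m. first_in m \<subseteq> N) \<le> j"
  using assms
proof induction
  case (base N)
  then show ?case by (simp add: Least_le)
next
  case (step N l P)
  let ?v = "\<lambda>N. LEAST m. first_in m \<subseteq> N"
  have N: "left_submodule N" "first_in j \<subseteq> N"
    using chain_subset[OF step.hyps(1)] chain_left_submodule[OF step.hyps(1)] by auto
  have P: "P = first_in (?v P)"
    using left_submodule_eq_first_in[OF step.hyps(2)] N(2) step.hyps(3) by blast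
  have Neq: "N = first_in (?v N)" by (rule left_submodule_eq_first_in[OF N])
  have "?v P \<le> ?v N"
    using Neq step.hyps(3) by (intro Least_le) auto
  moreover have "?v P \<noteq> ?v N" using P Neq step.hyps(3) by auto
  ultimately show ?case using step.IH by simp
qed

text \<open>Two consecutive terms are separated by the constant sequence
  \<open>c ^ (j - Suc m)\<close>; the bound \<open>j \<le> n\<close> makes this power
  nonzero.\<close>

lemma chain_first_in:
  assumes "j \<le> n"
  shows "m \<le> j \<Longrightarrow> chain (first_in j) (first_in (j - m)) m"
proof (induction m)
  case 0
  show ?case by (rule chain.base) (auto intro: left_submodule_first_in)
next
  case (Suc m)
  then have m: "Suc (j - Suc m) = j - m" "j - Suc m < n" using assms by simp_all
  have "pow_ideal (j - m) \<subseteq> pow_ideal (j - Suc m)"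
    unfolding m(1)[symmetric] by (auto simp: pow_ideal_def simp flip: mult.assoc)
  then have "first_in (j - m) \<subseteq> first_in (j - Suc m)" by (auto simp: first_in_def)
  moreover have "(\<lambda>_. c ^ (j - Suc m)) \<in> first_in (j - Suc m)"
    unfolding first_in_def pow_ideal_def by (auto intro: image_eqI[of _ _ 1])
  moreover have "(\<lambda>_. c ^ (j - Suc m)) \<notin> first_in (j - m)"
    using pow_mem_pow_ideal[of "j - Suc m" "j - m"] m by (auto simp: first_in_def)
  ultimately have "first_in (j - m) \<subset> first_in (j - Suc m)" by blast
  then show ?case using Suc by (intro chain.step left_submodule_first_in) auto
qed

lemma colength_first_in:
  assumes "j \<le> n"
  shows "finite_colength (first_in j)" "colength (first_in j) = j"
proof -
  have *: "l \<le> j" if "chain (first_in j) N l" for N l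
    using chain_first_in_le[OF that] by simp
  then show fin: "finite_colength (first_in j)" by (auto simp: finite_colength_def)
  have "j \<le> colength (first_in j)"
    using colength_ge[OF fin chain_first_in[OF assms order.refl]] .
  then show "colength (first_in j) = j"
    using * colength_attained[OF fin] by (blast intro: order.antisym)
qed

section \<open>Lengths of row spaces\<close>

lemma linear_shift: "linear_map (\<lambda>x i. x (r + i))"
  by (simp add: linear_map_def fun_eq_iff)

text \<open>The kernel contains all vectors whose first \<open>dim_row A\<close> entries lie in the
  ideal of \<open>c ^ k\<close>. These have finite colength by induction on the number of entries,
  splitting off the first coordinate and shifting the rest.\<close>

lemma finite_colength_kernel:
  assumes "k \<le> n"
  shows "finite_colength (kernel k A)"
proof -
  let ?B = "\<lambda>r. {x :: nat \<Rightarrow> 'a. \<forall>i<r. x i \<in> pow_ideal k}"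
  have sub: "left_submodule (?B r)" for r
    by (auto simp: left_submodule_def pow_ideal_add pow_ideal_mult_left)
  have "finite_colength (?B r)" for r
  proof (induction r)
    case 0
    then show ?case by (simp add: colength_UNIV)
  next
    case (Suc r)
    have "?B (Suc r) = first_in k \<inter> (\<lambda>x i. x (1 + i)) -` ?B r"
      by (auto simp: first_in_def less_Suc_eq_0_disj)
    moreover have "finite_colength \<dots>"
      by (rule colength_Int(1)[OF left_submodule_first_in left_submodule_vimage[OF linear_shift sub]
            colength_first_in(1)[OF assms] colength_vimage(1)[OF linear_shift sub Suc]])
    ultimately show ?case by simp
  qed
  moreover have "?B (dim_row A) \<subseteq> kernel k A"
    by (auto simp: kernel_def ideal_vecs_def row_act_def intro!: pow_ideal_sum pow_ideal_mult_right)
  ultimately show ?thesis using colength_antimono(1)[of "?B (dim_row A)"] by simp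
qed

lemma kernel_mult:
  assumes "dim_col A = dim_row B"
  shows "kernel k (A * B) = row_act A -` kernel k B"
  by (auto simp: kernel_def row_act_mult[OF assms])

text \<open>Modulo \<open>c ^ k\<close>, the row space of \<open>A * B\<close> is an image of that
  of \<open>A\<close> and a submodule of that of \<open>B\<close>.\<close>

lemma colength_kernel_mult:
  assumes "dim_col A = dim_row B" "k \<le> n"
  shows "colength (kernel k (A * B)) \<le> colength (kernel k A)"
    and "colength (kernel k (A * B)) \<le> colength (kernel k B)"
proof -
  have "kernel k A \<subseteq> kernel k (A * B)"
    by (auto simp: kernel_def row_act_mult[OF assms(1)] row_act_ideal_vecs)
  then show "colength (kernel k (A * B)) \<le> colength (kernel k A)"
    by (rule colength_antimono(2)[OF _ finite_colength_kernel[OF assms(2)]])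
  show "colength (kernel k (A * B)) \<le> colength (kernel k B)"
    unfolding kernel_mult[OF assms(1)]
    by (rule colength_vimage(2)[OF linear_row_act left_submodule_kernel
          finite_colength_kernel[OF assms(2)]])
qed

lemma kernel_upper_block:
  assumes "E \<in> carrier_mat (dim_row A) (dim_col B)"
  shows "x \<in> kernel k (upper_block A E B) \<longleftrightarrow> x \<in> kernel k A \<and>
    (\<forall>j. row_act E x j + row_act B (\<lambda>i. x (dim_row A + i)) j \<in> pow_ideal k)"
    (is "?L \<longleftrightarrow> ?R")
proof
  assume L: ?L
  then have *: "row_act (upper_block A E B) x j \<in> pow_ideal k" for j
    by (auto simp: kernel_def ideal_vecs_def)
  have "row_act A x j \<in> pow_ideal k" for j
  proof (cases "j < dim_col A")
    case True
    then show ?thesis using *[of j] row_act_upper_block[OF assms, of x j] by simp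
  qed (simp add: row_act_def)
  moreover have "row_act E x j + row_act B (\<lambda>i. x (dim_row A + i)) j \<in> pow_ideal k" for j
    using *[of "dim_col A + j"] row_act_upper_block[OF assms, of x "dim_col A + j"] by simp
  ultimately show ?R by (auto simp: kernel_def ideal_vecs_def)
next
  assume ?R
  then show ?L by (auto simp: kernel_def ideal_vecs_def row_act_upper_block[OF assms])
qed

lemma kernel_diag_sum:
  "kernel k (diag_sum A B) = kernel k A \<inter> (\<lambda>x i. x (dim_row A + i)) -` kernel k B"
  by (auto simp: diag_sum_upper_block kernel_upper_block) (auto simp: kernel_def ideal_vecs_def)

text \<open>Two chains are stacked: a longest one above the kernel of \<open>A\<close>, and below it
  one that stays inside the kernel of \<open>A\<close>, transported from a longest chain above the
  kernel of \<open>B\<close>.\<close>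

lemma colength_kernel_upper_block:
  assumes E: "E \<in> carrier_mat (dim_row A) (dim_col B)" and k: "k \<le> n"
  shows "colength (kernel k A) + colength (kernel k B) \<le> colength (kernel k (upper_block A E B))"
proof -
  let ?U = "kernel k (upper_block A E B)"
  \<comment> \<open>A vector for the rows of \<open>B\<close> is placed behind zeros for the rows of
    \<open>A\<close>; the preimage of \<open>?U\<close> is then the kernel of
    \<open>B\<close>.\<close>
  let ?S = "\<lambda>(y :: nat \<Rightarrow> 'a) i. if i < dim_row A then 0 else y (i - dim_row A)"
  have lin: "linear_map ?S" by (auto simp: linear_map_def fun_eq_iff)
  have zero: "row_act A (?S y) j = 0" "row_act E (?S y) j = 0" for y j
    using E by (auto simp: row_act_def)
  have SA: "?S y \<in> kernel k A" for y
    by (simp add: kernel_def ideal_vecs_def zero)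
  have SU: "?S y \<in> ?U \<longleftrightarrow> y \<in> kernel k B" for y
    using SA[of y] by (simp add: kernel_upper_block[OF E] zero) (simp add: kernel_def ideal_vecs_def)
  have UA: "?U \<subseteq> kernel k A" using kernel_upper_block[OF E] by blast
  obtain P where P: "chain (kernel k A) P (colength (kernel k A))"
    using colength_attained[OF finite_colength_kernel[OF k]] by blast
  obtain Q where Q: "chain (kernel k B) Q (colength (kernel k B))"
    using colength_attained[OF finite_colength_kernel[OF k]] by blast
  have "?S -` ?U = kernel k B" using SU by auto
  then have "chain ?U (sum_mod (?S ` Q) ?U) (colength (kernel k B))"
    using chain_vimage[OF lin left_submodule_kernel[of k "upper_block A E B"]] Q by simp
  moreover have "sum_mod (?S ` Q) ?U \<subseteq> kernel k A"
    using SA UA left_submodule_add[OF left_submodule_kernel] by (auto simp: sum_mod_def)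
  ultimately have "chain ?U P (colength (kernel k B) + colength (kernel k A))"
    using chain_concat[OF P] by blast
  then show ?thesis
    using colength_ge[OF finite_colength_kernel[OF k]] by (metis add.commute)
qed

text \<open>The kernel is an intersection, which gives one inequality; the other is the block
  inequality with zero corner.\<close>

lemma colength_kernel_diag_sum:
  assumes "k \<le> n"
  shows "colength (kernel k (diag_sum A B)) = colength (kernel k A) + colength (kernel k B)"
proof (rule antisym)
  have B: "finite_colength ((\<lambda>x i. x (dim_row A + i)) -` kernel k B)"
      "colength ((\<lambda>x i. x (dim_row A + i)) -` kernel k B) \<le> colength (kernel k B)"
    using colength_vimage[OF linear_shift left_submodule_kernel finite_colength_kernel[OF assms]]
    by blast+
  show "colength (kernel k (diag_sum A B)) \<le> colength (kernel k A) + colength (kernel k B)"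
    unfolding kernel_diag_sum
    using colength_Int(2)[OF left_submodule_kernel
        left_submodule_vimage[OF linear_shift left_submodule_kernel]
        finite_colength_kernel[OF assms] B(1), of A] B(2) by linarith
  show "colength (kernel k A) + colength (kernel k B) \<le> colength (kernel k (diag_sum A B))"
    unfolding diag_sum_upper_block by (rule colength_kernel_upper_block) (use assms in auto)
qed

lemma kernel_elem_mat:
  assumes "k \<le> n"
  shows "kernel k (elem_mat (c ^ i)) = first_in (k - i)"
proof -
  have "x \<in> kernel k (elem_mat (c ^ i)) \<longleftrightarrow> x 0 * c ^ i \<in> pow_ideal k" for x
    by (auto simp: kernel_def ideal_vecs_def row_act_def elem_mat_def)
  moreover have "x 0 * c ^ i \<in> pow_ideal k \<longleftrightarrow> x \<in> first_in (k - i)" for x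
  proof
    assume "x \<in> first_in (k - i)"
    then obtain y where "x 0 = y * c ^ (k - i)" by (auto simp: first_in_def pow_ideal_def)
    \<comment> \<open>With truncated subtraction the exponent \<open>k - i + i - k\<close> is 0 for
      \<open>i \<le> k\<close> and \<open>i - k\<close> otherwise.\<close>
    then have "x 0 * c ^ i = y * c ^ (k - i + i - k) * c ^ k"
      by (simp add: mult.assoc flip: power_add)
    then show "x 0 * c ^ i \<in> pow_ideal k" by (auto simp: pow_ideal_def)
  qed (use pow_ideal_cancel assms in \<open>auto simp: first_in_def\<close>)
  ultimately show ?thesis by blast
qed

text \<open>The ring modulo \<open>c ^ k\<close> has length \<open>k\<close>, so division by
  \<open>k\<close> normalizes the rank of 1. This provides a witness for \<open>SOME\<close> in
  \<open>rank_k\<close>.\<close>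

lemma is_rank_k_colength:
  assumes k: "0 < k" "k \<le> n"
  shows "is_rank_k c n k (\<lambda>A. colength (kernel k A) / k)"
proof -
  have e: "colength (kernel k (elem_mat (c ^ i))) = k - i" for i
    using kernel_elem_mat[OF k(2)] colength_first_in(2)[of "k - i"] k(2) by simp
  have one: "colength (kernel k (elem_mat 1)) = k" using e[of 0] by simp
  have z: "colength (kernel k (0\<^sub>m r s)) = 0" for r s
  proof -
    have "kernel k (0\<^sub>m r s) = UNIV" by (auto simp: kernel_def ideal_vecs_def)
    then show ?thesis by (simp add: colength_UNIV)
  qed
  show ?thesis
    unfolding is_rank_k_def sylvester_rank_functions_def
    using k colength_kernel_upper_block[OF _ k(2)]
    by (auto simp: z one e colength_kernel_mult colength_kernel_diag_sum divide_right_mono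
        of_nat_diff add_divide_distrib[symmetric] simp flip: of_nat_add)
qed

lemma is_rank_k_rank_k: "0 < k \<Longrightarrow> k \<le> n \<Longrightarrow> is_rank_k c n k (rank_k c n k)"
  unfolding rank_k_def by (rule someI[of "is_rank_k c n k", OF is_rank_k_colength])

end

section \<open>Weighted sums of multiplicity functions\<close>

text \<open>This is \<open>k\<close> times the rank rk_k of the sum with multiplicities
  \<open>m\<close>; truncated subtraction encodes the value 0 on \<open>c ^ i\<close> for
  \<open>i \<ge> k\<close>.\<close>

definition level :: "nat \<Rightarrow> (nat \<Rightarrow> nat) \<Rightarrow> nat \<Rightarrow> nat" where
  "level n m k = (\<Sum>i<n. m i * (k - i))"

definition add1 :: "(nat \<Rightarrow> nat) \<Rightarrow> nat \<Rightarrow> nat \<Rightarrow> nat" where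
  "add1 m i = m(i := Suc (m i))"

lemma level_cong: "(\<And>i. i < n \<Longrightarrow> m i = m' i) \<Longrightarrow> level n m k = level n m' k"
  by (simp add: level_def)

lemma level_0 [simp]: "level n m 0 = 0"
  by (simp add: level_def)

text \<open>Raising \<open>k\<close> by one adds one to the weight of every exponent up to
  \<open>k\<close>; \<open>k < n\<close> keeps all of these in the sum.\<close>

lemma level_Suc:
  assumes "k < n"
  shows "level n m (Suc k) = level n m k + (\<Sum>i\<le>k. m i)"
proof -
  have "m i * (Suc k - i) = m i * (k - i) + (if i \<le> k then m i else 0)" for i
    by (simp add: Suc_diff_le)
  then have "level n m (Suc k) = level n m k + (\<Sum>i<n. if i \<le> k then m i else 0)"
    by (simp add: level_def sum.distrib)
  moreover have "(\<Sum>i<n. if i \<le> k then m i else 0) = (\<Sum>i\<le>k. m i)"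
    by (rule sum.mono_neutral_cong_right) (use assms in auto)
  ultimately show ?thesis by simp
qed

lemma level_add1:
  assumes "k \<le> n"
  shows "level n (add1 m i) k = level n m k + (k - i)"
proof (cases "i < n")
  case True
  then have "level n f k = f i * (k - i) + (\<Sum>j\<in>{..<n} - {i}. f j * (k - j))" for f
    unfolding level_def by (intro sum.remove) auto
  then show ?thesis by (simp add: add1_def)
next
  \<comment> \<open>An exponent \<open>i \<ge> n\<close> is not counted, and \<open>k - i\<close> is
    0 because \<open>k \<le> n\<close>.\<close>
  case False
  then show ?thesis using assms by (simp add: level_def add1_def)
qed

text \<open>Equal levels have equal increments, which are partial sums of the multiplicities; their
  differences recover the multiplicities.\<close>

lemma level_inj:
  assumes "\<And>k. k \<le> n \<Longrightarrow> level n m k = level n m' k" and "i < n"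
  shows "m i = m' i"
proof -
  have S: "(\<Sum>i\<le>k. m i) = (\<Sum>i\<le>k. m' i)" if "k < n" for k
    using assms(1)[of k] assms(1)[of "Suc k"] level_Suc[OF that, of m] level_Suc[OF that, of m'] that
    by simp
  show ?thesis
  proof (cases i)
    case 0
    then show ?thesis using S[of 0] assms(2) by simp
  next
    case (Suc j)
    then show ?thesis using S[of j] S[of i] assms(2) by simp
  qed
qed

lemma add1_commute: "add1 (add1 m i) j = add1 (add1 m j) i"
  by (auto simp: add1_def fun_eq_iff)

text \<open>One unit is removed at a time, perhaps twice at the same exponent;
  \<open>add1_commute\<close> puts the two in order.\<close>

lemma split_two:
  assumes "2 \<le> (\<Sum>i\<in>{p..q}. m i)"
  shows "\<exists>i j m0. p \<le> i \<and> i \<le> j \<and> j \<le> q \<and> m = add1 (add1 m0 i) j"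
proof -
  have "(\<Sum>i\<in>{p..q}. m i) \<noteq> 0" using assms by linarith
  then obtain i where i: "i \<in> {p..q}" "m i \<noteq> 0" by (metis sum.neutral)
  define m1 where "m1 = m(i := m i - 1)"
  have m: "m = add1 m1 i" using i by (auto simp: m1_def add1_def)
  have "(\<Sum>i\<in>{p..q}. f i) = f i + (\<Sum>j\<in>{p..q} - {i}. f j)" for f :: "nat \<Rightarrow> nat"
    using i by (intro sum.remove) auto
  then have "(\<Sum>i\<in>{p..q}. m i) = Suc (\<Sum>i\<in>{p..q}. m1 i)"
    by (simp add: m add1_def)
  then have "(\<Sum>i\<in>{p..q}. m1 i) \<noteq> 0" using assms by linarith
  then obtain j where j: "j \<in> {p..q}" "m1 j \<noteq> 0" by (metis sum.neutral)
  define m0 where "m0 = m1(j := m1 j - 1)"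
  have "m1 = add1 m0 j" using j by (auto simp: m0_def add1_def)
  then have "m = add1 (add1 m0 j) i" using m by simp
  moreover have "p \<le> i" "i \<le> q" "p \<le> j" "j \<le> q" using i j by auto
  ultimately show ?thesis by (metis add1_commute nle_le)
qed

text \<open>On a maximal interval \<open>[p, q]\<close> on which the level of \<open>m\<close> is strictly smaller, the slope of the
  level of \<open>m\<close> starts below and ends above that of \<open>m'\<close>, so it grows by at least 2; this growth is the
  number of exponents in \<open>[p, q]\<close>. The assumption on \<open>m n\<close> covers the case \<open>q = n\<close>.\<close>

lemma exchange_pair:
  assumes le: "\<And>k. k \<le> n \<Longrightarrow> level n m k \<le> level n m' k"
    and ex: "\<exists>k\<le>n. level n m k \<noteq> level n m' k"
    and two: "2 \<le> m n"
  shows "\<exists>i j m0. 0 < i \<and> i \<le> j \<and> j \<le> n \<and> m = add1 (add1 m0 i) j \<and>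
    (\<forall>k. i \<le> k \<and> k \<le> j \<longrightarrow> level n m k < level n m' k)"
proof -
  define p where "p = (LEAST k. k \<le> n \<and> level n m k \<noteq> level n m' k)"
  have p: "p \<le> n" "level n m p \<noteq> level n m' p"
    using LeastI_ex[OF ex] by (simp_all add: p_def)
  have before: "level n m k = level n m' k" if "k < p" for k
    using not_less_Least[of k "\<lambda>k. k \<le> n \<and> level n m k \<noteq> level n m' k"] that p(1)
    by (auto simp: p_def)
  have "p \<noteq> 0" using p(2) by (metis level_0)
  then obtain p' where p': "p = Suc p'" by (cases p) auto
  \<comment> \<open>\<open>E\<close> marks the end of the gap that opens at \<open>p\<close>; the
    alternative \<open>n < k\<close> is a sentinel that makes \<open>r\<close> exist.\<close>
  define E where "E k \<longleftrightarrow> p < k \<and> (n < k \<or> level n m k = level n m' k)" for k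
  define r where "r = (LEAST k. E k)"
  have "E (Suc n)" using p(1) by (simp add: E_def)
  then have r: "E r" "r \<le> Suc n" unfolding r_def by (auto intro: LeastI Least_le)
  have strict: "level n m k < level n m' k" if "p \<le> k" "k < r" for k
  proof (cases "k = p")
    case True
    then show ?thesis using p le[of p] by simp
  next
    case False
    have "\<not> E k" using not_less_Least[of k E] that(2) by (simp add: r_def)
    then show ?thesis using False that r(2) le[of k] by (auto simp: E_def)
  qed
  obtain q where q: "r = Suc q" "p \<le> q" "q \<le> n" using r by (cases r) (auto simp: E_def)
  have "2 \<le> (\<Sum>i\<in>{p..q}. m i)"
  proof (cases "q = n")
    case True
    then have "m n \<le> (\<Sum>i\<in>{p..q}. m i)" using p(1) by (intro member_le_sum) auto
    then show ?thesis using two by linarith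
  next
    case False
    then have qn: "q < n" using q by simp
    have "level n m r = level n m' r" using r q qn by (auto simp: E_def)
    then have "(\<Sum>i\<le>q. m' i) < (\<Sum>i\<le>q. m i)"
      using level_Suc[OF qn, of m] level_Suc[OF qn, of m'] strict[of q] q by simp
    moreover have "(\<Sum>i\<le>p'. m i) < (\<Sum>i\<le>p'. m' i)"
      using level_Suc[of p' n m] level_Suc[of p' n m'] strict[of p] before[of p'] p(1) q p' by simp
    moreover have "(\<Sum>i\<le>p'. m' i) \<le> (\<Sum>i\<le>q. m' i)"
      using q p' by (intro sum_mono2) auto
    moreover have "(\<Sum>i\<le>q. m i) = (\<Sum>i\<le>p'. m i) + (\<Sum>i\<in>{p..q}. m i)"
    proof -
      have "{..q} = {..p'} \<union> {p..q}" "{..p'} \<inter> {p..q} = {}" using q p' by auto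
      then show ?thesis by (simp add: sum.union_disjoint)
    qed
    ultimately show ?thesis by linarith
  qed
  from split_two[OF this] obtain i j m0
    where ij: "p \<le> i" "i \<le> j" "j \<le> q" and m: "m = add1 (add1 m0 i) j" by blast
  have "0 < i" "j \<le> n" using ij q p' by simp_all
  moreover have "\<forall>k. i \<le> k \<and> k \<le> j \<longrightarrow> level n m k < level n m' k"
    using strict ij q(1) by simp
  ultimately show ?thesis using ij(2) m by blast
qed

text \<open>Since only the multiplicities below \<open>n\<close> matter, the value at \<open>n\<close> may be reset to 2 before
  every exchange.\<close>

lemma exchange_induct:
  fixes f :: "(nat \<Rightarrow> nat) \<Rightarrow> 'b::preorder"
  assumes step: "\<And>m i j. 0 < i \<Longrightarrow> i \<le> j \<Longrightarrow>
      f (add1 (add1 m i) j) \<le> f (add1 (add1 m (i - 1)) (Suc j))"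
    and cong: "\<And>m m'. (\<And>i. i < n \<Longrightarrow> m i = m' i) \<Longrightarrow> f m = f m'"
    and le: "\<And>k. k \<le> n \<Longrightarrow> level n m k \<le> level n m' k"
  shows "f m \<le> f m'"
  using le
\<comment> \<open>The measure is the total gap between the levels; an exchange lowers it at every
  \<open>k\<close> from \<open>i\<close> to \<open>j\<close>.\<close>
proof (induction "\<Sum>k\<le>n. level n m' k - level n m k" arbitrary: m rule: less_induct)
  case less
  show ?case
  proof (cases "\<exists>k\<le>n. level n m k \<noteq> level n m' k")
    case False
    then have "level n m k = level n m' k" if "k \<le> n" for k using that by blast
    then have "f m = f m'" by (intro cong level_inj[of n m m'])
    then show ?thesis by simp
  next
    case True
    let ?m = "m(n := 2)"
    have lm: "level n ?m k = level n m k" for k by (rule level_cong) simp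
    have fm: "f ?m = f m" by (rule cong) simp
    obtain i j m0 where ij: "0 < i" "i \<le> j" "j \<le> n" "?m = add1 (add1 m0 i) j"
      and lt: "\<And>k. i \<le> k \<Longrightarrow> k \<le> j \<Longrightarrow> level n m k < level n m' k"
      using exchange_pair[of n ?m m'] less.prems True unfolding lm by auto
    \<comment> \<open>For \<open>j = n\<close> the new exponent is \<open>Suc n\<close>, to which
      \<open>level_add1\<close> still applies with contribution 0.\<close>
    let ?m' = "add1 (add1 m0 (i - 1)) (Suc j)"
    have l: "level n ?m' k = level n m k + (if i \<le> k \<and> k \<le> j then 1 else 0)" if "k \<le> n" for k
      using lm[of k] ij unfolding ij(4) by (auto simp: level_add1[OF that])
    have le': "level n ?m' k \<le> level n m' k" if "k \<le> n" for k
      using less.prems[OF that] lt[of k] l[OF that] by auto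
    have "(\<Sum>k\<le>n. level n m' k - level n ?m' k) < (\<Sum>k\<le>n. level n m' k - level n m k)"
    proof (rule sum_strict_mono_ex1)
      show "\<forall>k\<in>{..n}. level n m' k - level n ?m' k \<le> level n m' k - level n m k"
        using l by auto
      have "level n m' i - level n ?m' i < level n m' i - level n m i"
        using l[of i] lt[of i] ij by simp
      then show "\<exists>k\<in>{..n}. level n m' k - level n ?m' k < level n m' k - level n m k"
        using ij by (intro bexI[of _ i]) auto
    qed simp
    then have "f ?m' \<le> f m'" using less.hyps le' by blast
    moreover have "f m \<le> f ?m'" using step[OF ij(1,2), of m0] fm ij(4) by simp
    ultimately show ?thesis using order_trans by blast
  qed
qed

section \<open>Reduction to diagonal form\<close>

lemma index_mult_mat_sum:
  assumes "i < dim_row A" "j < dim_col B" "dim_col A = dim_row B"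
  shows "(A * B) $$ (i, j) = (\<Sum>l<dim_row B. A $$ (i, l) * B $$ (l, j))"
  using assms by (simp add: scalar_prod_def lessThan_atLeast0)

lemma elem_mat_dim [simp]: "dim_row (elem_mat x) = 1" "dim_col (elem_mat x) = 1"
  by (simp_all add: elem_mat_def)

lemma malc_class_diag_sum:
  assumes "A \<in> rect_mats" "B \<in> rect_mats"
  shows "malc_class (diag_sum A B) = malc_class A + malc_class B"
  by (rule plus_malc_semigroup.abs_eq[symmetric]) (use assms in \<open>simp_all add: malc_equiv_refl_iff\<close>)

lemma malc_class_le_iff:
  assumes "A \<in> rect_mats" "B \<in> rect_mats"
  shows "malc_class A \<le> malc_class B \<longleftrightarrow> malc_le A B"
  by (rule less_eq_malc_semigroup.abs_eq) (use assms in \<open>simp_all add: malc_equiv_refl_iff\<close>)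

lemma malc_class_le_prod:
  assumes "A = L * B * R" "A \<in> rect_mats" "B \<in> rect_mats"
    and "L \<in> carrier_mat (dim_row A) (dim_row B)" "R \<in> carrier_mat (dim_col B) (dim_col A)"
  shows "malc_class A \<le> malc_class B"
proof -
  have "malc_le (L * B * R) B"
    by (rule malc_le_prod) (use assms(2-5) in \<open>auto simp: rect_mats_def\<close>)
  then show ?thesis using assms malc_class_le_iff by blast
qed

lemma malc_class_surj: "\<exists>A\<in>rect_mats. a = malc_class A"
  by (induction a rule: malc_semigroup.abs_induct) (auto simp: malc_equiv_refl_iff)

lemma malc_class_zero: "malc_class (elem_mat 0) = 0"
  by (rule zero_malc_semigroup.abs_eq[symmetric])

lemma zero_le_malc_class:
  fixes A :: "'a::ring_1 mat"
  assumes "A \<in> rect_mats"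
  shows "0 \<le> malc_class A"
  unfolding malc_class_zero[symmetric]
proof (rule malc_class_le_prod)
  show "elem_mat 0 = 0\<^sub>m 1 (dim_row A) * A * (0\<^sub>m (dim_col A) 1 :: 'a mat)"
    by (rule eq_matI) (auto simp: elem_mat_def)
qed (use assms in \<open>auto simp: elem_mat_def rect_mats_def\<close>)

lemma malc_class_zero_mat:
  assumes "0 < r" "0 < s"
  shows "malc_class (0\<^sub>m r s :: 'a::ring_1 mat) = 0"
proof (rule antisym)
  show "malc_class (0\<^sub>m r s :: 'a mat) \<le> 0"
    unfolding malc_class_zero[symmetric]
  proof (rule malc_class_le_prod)
    show "0\<^sub>m r s = 0\<^sub>m r 1 * elem_mat 0 * (0\<^sub>m 1 s :: 'a mat)"
      by (rule eq_matI) (auto simp: elem_mat_def scalar_prod_def)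
  qed (use assms in \<open>auto simp: elem_mat_def rect_mats_def\<close>)
  show "0 \<le> malc_class (0\<^sub>m r s :: 'a mat)"
    by (rule zero_le_malc_class) (use assms in \<open>auto simp: rect_mats_def\<close>)
qed

lemma sum_single_mult:
  fixes f g :: "nat \<Rightarrow> 'b::semiring_0"
  assumes "p < r"
  shows "(\<Sum>l<r. (if l = p then f l else 0) * g l) = f p * g p"
    and "(\<Sum>l<r. f l * (if l = p then g l else 0)) = f p * g p"
  using assms by (simp_all add: if_distrib[of "\<lambda>x. x * _"] if_distrib[of "\<lambda>x. _ * x"]
      cong: if_cong)

lemma diag_sum_elem_index:
  assumes "i \<le> dim_row A" "j \<le> dim_col A"
  shows "diag_sum (elem_mat a) A $$ (i, j) =
    (if i = 0 \<and> j = 0 then a else if i = 0 \<or> j = 0 then 0 else A $$ (i - 1, j - 1))"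
  using assms by (auto simp: diag_sum_def elem_mat_def)

text \<open>Clearing the pivot row \<open>p\<close> and the pivot column \<open>q\<close> to zero, instead of deleting them, keeps the dimensions and avoids empty matrices.\<close>

lemma malc_class_pivot:
  fixes A :: "'a::ring_1 mat" and x v w :: "nat \<Rightarrow> 'a"
  assumes A: "A \<in> carrier_mat r s" and p: "p < r" and q: "q < s"
    and col: "\<And>i. i < r \<Longrightarrow> A $$ (i, q) = v i * A $$ (p, q)"
    and row: "\<And>j. j < s \<Longrightarrow> A $$ (p, j) = A $$ (p, q) * w j"
    and pivot: "A $$ (p, q) = u * d" "u' * u = 1" "v p = 1" "w q = 1"
    and A': "A' = mat r s (\<lambda>(i, j). A $$ (i, j) - v i * A $$ (p, j))"
  shows "malc_class A = malc_class (elem_mat d) + malc_class A'"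
proof -
  have r: "0 < r" "0 < s" using p q by auto
  have rect: "A \<in> rect_mats" "A' \<in> rect_mats" using A r by (auto simp: A' rect_mats_def)
  let ?D = "diag_sum (elem_mat d) A'"
  have D: "?D \<in> rect_mats" using rect by (simp add: diag_sum_rect)
  have dims: "dim_row A = r" "dim_col A = s" "dim_row A' = r" "dim_col A' = s"
    "dim_row ?D = Suc r" "dim_col ?D = Suc s"
    using A by (auto simp: A' elem_mat_def)
  have Dix: "?D $$ (i, j) =
    (if i = 0 \<and> j = 0 then d else if i = 0 \<or> j = 0 then 0 else A' $$ (i - 1, j - 1))"
    if "i \<le> r" "j \<le> s" for i j
    using diag_sum_elem_index[of i A' j d] that dims by simp
  have A'q: "A' $$ (i, q) = 0" if "i < r" for i
    using that q col[OF that] by (simp add: A')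
  \<comment> \<open>The product of these factors is the outer product with entries
    \<open>v i * u * d * w j\<close>, plus \<open>A'\<close>. By \<open>row\<close>, this outer
    product is what \<open>A'\<close> has subtracted from \<open>A\<close>.\<close>
  let ?L = "mat r (Suc r) (\<lambda>(i, j). if j = 0 then v i * u else if j = Suc i then 1 else 0)"
  let ?R = "mat (Suc s) s (\<lambda>(i, j). if i = 0 then w j else if i = Suc j then 1 else 0)"
  have "malc_class A \<le> malc_class ?D"
  proof (rule malc_class_le_prod)
    show "A = ?L * ?D * ?R"
    proof (rule eq_matI)
      fix i j assume "i < dim_row (?L * ?D * ?R)" "j < dim_col (?L * ?D * ?R)"
      then have ij: "i < r" "j < s" by simp_all
      have LD: "(?L * ?D) $$ (i, l) = (if l = 0 then v i * u * d else A' $$ (i, l - 1))"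
        if "l \<le> s" for l
      proof -
        have "(?L * ?D) $$ (i, l) = (\<Sum>k<Suc r. ?L $$ (i, k) * ?D $$ (k, l))"
          using index_mult_mat_sum[of i ?L l ?D] that ij dims by simp
        moreover have "(\<Sum>k<r. ?L $$ (i, Suc k) * ?D $$ (Suc k, l))
            = (\<Sum>k<r. (if k = i then 1 else 0) * ?D $$ (Suc k, l))"
          using ij by (intro sum.cong) auto
        ultimately have "(?L * ?D) $$ (i, l) = ?L $$ (i, 0) * ?D $$ (0, l) + ?D $$ (Suc i, l)"
          using sum_single_mult(1)[OF ij(1), of "\<lambda>_. 1" "\<lambda>k. ?D $$ (Suc k, l)"]
          by (simp only: sum.lessThan_Suc_shift mult_1_left)
        then show ?thesis using that ij by (simp add: Dix)
      qed
      have "(?L * ?D * ?R) $$ (i, j) = v i * u * d * w j + A' $$ (i, j)"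
      proof -
        have "(?L * ?D * ?R) $$ (i, j) = (\<Sum>k<Suc s. (?L * ?D) $$ (i, k) * ?R $$ (k, j))"
          using index_mult_mat_sum[of i "?L * ?D" j ?R] ij dims by simp
        moreover have "(\<Sum>k<s. (?L * ?D) $$ (i, Suc k) * ?R $$ (Suc k, j))
            = (\<Sum>k<s. (?L * ?D) $$ (i, Suc k) * (if k = j then 1 else 0))"
          using ij by (intro sum.cong) auto
        ultimately have "(?L * ?D * ?R) $$ (i, j)
            = (?L * ?D) $$ (i, 0) * ?R $$ (0, j) + (?L * ?D) $$ (i, Suc j)"
          using sum_single_mult(2)[OF ij(2), of "\<lambda>k. (?L * ?D) $$ (i, Suc k)" "\<lambda>_. 1"]
          by (simp only: sum.lessThan_Suc_shift mult_1_right)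
        then show ?thesis using ij by (simp add: LD del: index_mult_mat(1))
      qed
      also have "v i * u * d * w j = v i * A $$ (p, j)"
        using row[OF ij(2)] pivot(1) by (simp add: mult.assoc)
      finally show "A $$ (i, j) = (?L * ?D * ?R) $$ (i, j)" using ij by (simp add: A')
    qed (simp_all add: dims)
  qed (use rect D dims in auto)
  moreover
  \<comment> \<open>Conversely, row 0 of \<open>?L\<close> takes \<open>u'\<close> times the pivot
    row and the other rows subtract left multiples of it by \<open>v\<close>; \<open>?R\<close>
    extracts column \<open>q\<close> and subtracts its right multiples by \<open>w\<close>
    elsewhere. Index 0 belongs to \<open>d\<close>, so the indices of \<open>A'\<close> are shifted
    by one.\<close>
  let ?L = "mat (Suc r) r (\<lambda>(i, j). if i = 0 then if j = p then u' else 0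
      else (if j = i - 1 then 1 else 0) - (if j = p then v (i - 1) else 0))"
  let ?R = "mat s (Suc s) (\<lambda>(i, j). if j = 0 then if i = q then 1 else 0
      else (if i = j - 1 then 1 else 0) - (if i = q then w (j - 1) else 0))"
  have "malc_class ?D \<le> malc_class A"
  proof (rule malc_class_le_prod)
    show "?D = ?L * A * ?R"
    proof (rule eq_matI)
      fix i j assume "i < dim_row (?L * A * ?R)" "j < dim_col (?L * A * ?R)"
      then have ij: "i \<le> r" "j \<le> s" by simp_all
      have LA: "(?L * A) $$ (i, l) = (if i = 0 then u' * A $$ (p, l) else A' $$ (i - 1, l))"
        if "l < s" for l
        using that ij p
        by (auto simp: index_mult_mat_sum dims sum_single_mult left_diff_distrib sum_subtractf A'
            simp del: index_mult_mat(1))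
      have "(?L * A * ?R) $$ (i, j) = (if j = 0 then (?L * A) $$ (i, q)
          else (?L * A) $$ (i, j - 1) - (?L * A) $$ (i, q) * w (j - 1))"
        using ij q
        by (auto simp: index_mult_mat_sum[of _ "?L * A"] dims sum_single_mult right_diff_distrib
            sum_subtractf simp del: index_mult_mat(1))
      also have "\<dots> = ?D $$ (i, j)"
      proof -
        have uq: "u' * A $$ (p, q) = d"
          by (simp add: pivot(1,2) flip: mult.assoc)
        have uw: "u' * A $$ (p, l) = d * w l" if "l < s" for l
          by (simp add: row[OF that] uq flip: mult.assoc)
        have "A' $$ (i - 1, q) = 0" if "i \<noteq> 0" using that ij by (intro A'q) simp
        then show ?thesis
          using ij LA[OF q] LA[of "j - 1"] uq uw[of "j - 1"]
          by (cases "i = 0"; cases "j = 0") (simp_all add: Dix del: index_mult_mat(1))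
      qed
      finally show "?D $$ (i, j) = (?L * A * ?R) $$ (i, j)" by simp
    qed (simp_all add: dims)
  qed (use rect D dims in auto)
  ultimately have "malc_class A = malc_class ?D" by simp
  then show ?thesis using malc_class_diag_sum[OF _ rect(2)] by simp
qed

section \<open>Sums of classes of powers of \<open>c\<close>\<close>

context chain_ring
begin

definition gen :: "nat \<Rightarrow> 'a malc_semigroup" where
  "gen i = malc_class (elem_mat (c ^ i))"

definition comb :: "(nat \<Rightarrow> nat) \<Rightarrow> 'a malc_semigroup" where
  "comb m = (\<Sum>i<n. nat_multiple (m i) (gen i))"

lemma gen_eq_0: "n \<le> i \<Longrightarrow> gen i = 0"
  by (simp add: gen_def pow_eq_0 malc_class_zero)

lemma comb_cong: "(\<And>i. i < n \<Longrightarrow> m i = m' i) \<Longrightarrow> comb m = comb m'"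
  by (simp add: comb_def)

text \<open>An exponent \<open>i \<ge> n\<close> is ignored by \<open>comb\<close> and has
  \<open>gen i = 0\<close>, so exchanges may push exponents past \<open>n - 1\<close>.\<close>

lemma comb_add1: "comb (add1 m i) = comb m + gen i"
proof (cases "i < n")
  case True
  then have "comb f = nat_multiple (f i) (gen i) + (\<Sum>j\<in>{..<n} - {i}. nat_multiple (f j) (gen j))" for f
    unfolding comb_def by (intro sum.remove) auto
  then show ?thesis by (simp add: add1_def nat_multiple_def ac_simps)
next
  case False
  then have "comb (add1 m i) = comb m" by (intro comb_cong) (auto simp: add1_def)
  then show ?thesis using False by (simp add: gen_eq_0)
qed

text \<open>The matrix \<open>[c^(i+1), c^i; 0, c^j]\<close> is equivalent to \<open>diag(c^i, c^(j+1))\<close>.\<close>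

lemma gen_exchange:
  assumes "Suc i \<le> j"
  shows "gen (Suc i) + gen j \<le> gen i + gen (Suc j)"
proof -
  let ?U = "upper_block (elem_mat (c ^ Suc i)) (elem_mat (c ^ i)) (elem_mat (c ^ j))"
  let ?D = "diag_sum (elem_mat (c ^ i)) (elem_mat (c ^ Suc j))"
  have rect: "?U \<in> rect_mats" "?D \<in> rect_mats" by (auto simp: rect_mats_def elem_mat_def)
  \<comment> \<open>\<open>?L\<close> adds \<open>c ^ (j - i)\<close> times the first row to the
    second. \<open>?R\<close> turns the columns into \<open>c\<close> times the first minus the
    second, and the first; the lower left entry cancels.\<close>
  let ?L = "mat 2 2 (\<lambda>(a, b). if a = b then 1 else if b = 0 then c ^ (j - i) else 0)"
  let ?R = "mat 2 2 (\<lambda>(a, b). if b = 1 then if a = 0 then 1 else 0 else if a = 0 then c else - 1)"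
  have "gen (Suc i) + gen j = malc_class (diag_sum (elem_mat (c ^ Suc i)) (elem_mat (c ^ j)))"
    by (simp add: gen_def malc_class_diag_sum)
  also have "\<dots> \<le> malc_class ?U"
  proof (subst malc_class_le_iff)
    have "malc_step (diag_sum (elem_mat (c ^ Suc i)) (elem_mat (c ^ j))) ?U"
      by (rule malc_step.block[OF elem_mat_rect elem_mat_rect], rule carrier_matI)
        (simp_all only: elem_mat_dim)
    then show "malc_le (diag_sum (elem_mat (c ^ Suc i)) (elem_mat (c ^ j))) ?U"
      using rect(1) by (simp add: malc_le_def diag_sum_rect)
  qed (use rect in \<open>auto simp: diag_sum_rect\<close>)
  also have "\<dots> \<le> malc_class ?D"
  proof (rule malc_class_le_prod)
    have pw: "c ^ (j - i) * c ^ i = c ^ j"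
      using assms by (simp flip: power_add)
    show "?U = ?L * ?D * ?R"
    proof (rule eq_matI)
      fix a b assume "a < dim_row (?L * ?D * ?R)" "b < dim_col (?L * ?D * ?R)"
      then have "a = 0 \<or> a = 1" "b = 0 \<or> b = 1" by auto
      then show "?U $$ (a, b) = (?L * ?D * ?R) $$ (a, b)"
        by (auto simp: index_mult_mat_sum numeral_2_eq_2 diag_sum_def upper_block_def elem_mat_def
            pw power_commutes simp del: index_mult_mat(1))
    qed (simp_all add: elem_mat_def)
  qed (use rect in \<open>auto simp: elem_mat_def\<close>)
  also have "\<dots> = gen i + gen (Suc j)"
    by (simp add: gen_def malc_class_diag_sum)
  finally show ?thesis .
qed

lemma comb_mono:
  assumes "\<And>k. k \<le> n \<Longrightarrow> level n m k \<le> level n m' k"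
  shows "comb m \<le> comb m'"
proof (rule exchange_induct[where n = n])
  fix m i j assume "0 < i" "i \<le> (j :: nat)"
  then have "gen i + gen j \<le> gen (i - 1) + gen (Suc j)"
    using gen_exchange[of "i - 1" j] by simp
  then show "comb (add1 (add1 m i) j) \<le> comb (add1 (add1 m (i - 1)) (Suc j))"
    by (simp add: comb_add1 add.assoc add_left_mono)
next
  show "comb m = comb m'" if "\<And>i. i < n \<Longrightarrow> m i = m' i" for m m'
    using that by (rule comb_cong)
qed (rule assms)

text \<open>Induction on the number of nonzero rows: pivoting clears the pivot row, and rows that
  were zero remain zero.\<close>

lemma malc_class_eq_comb:
  assumes "A \<in> rect_mats"
  shows "\<exists>m. malc_class A = comb m"
  using assms
proof (induction "card {i. i < dim_row A \<and> (\<exists>j<dim_col A. A $$ (i, j) \<noteq> 0)}" arbitrary: A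
    rule: less_induct)
  case less
  define r s where "r = dim_row A" and "s = dim_col A"
  have A: "A \<in> carrier_mat r s" "0 < r" "0 < s"
    using less.prems by (auto simp: r_def s_def rect_mats_def)
  show ?case
  proof (cases "A = 0\<^sub>m r s")
    case True
    have "comb (\<lambda>_. 0) = 0" by (simp add: comb_def nat_multiple_def)
    then show ?thesis using True malc_class_zero_mat[OF A(2,3)] by metis
  next
    case False
    define P where "P i \<longleftrightarrow> (\<exists>p<r. \<exists>q<s. \<exists>u\<in>invertible_elements. A $$ (p, q) = u * c ^ i)" for i
    obtain p q where "p < r" "q < s" "A $$ (p, q) \<noteq> 0"
      using False A(1) by (metis carrier_matD eq_matI index_zero_mat)
    then have ex: "\<exists>i. i < n \<and> P i" using unit_pow[of "A $$ (p, q)"] unfolding P_def by blast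
    define d where "d = (LEAST i. i < n \<and> P i)"
    have d: "d < n" "P d" using LeastI_ex[OF ex] by (simp_all add: d_def)
    obtain p q u where pq: "p < r" "q < s" "u \<in> invertible_elements" "A $$ (p, q) = u * c ^ d"
      using d(2) by (auto simp: P_def)
    obtain u' where u': "u' * u = 1" "u * u' = 1" using pq(3) by (auto simp: invertible_elements_def)
    have nz: "A $$ (p, q) \<noteq> 0"
    proof
      assume "A $$ (p, q) = 0"
      then have "u' * u * c ^ d = 0" using pq(4) by (simp add: mult.assoc)
      then show False using u' pow_nz[OF d(1)] by simp
    qed
    \<comment> \<open>The factor of a zero entry is fixed as 0, so that zero rows get
      \<open>v i = 0\<close>; at the pivot it is \<open>u\<close>, so that \<open>v p = 1\<close>
      and \<open>w q = 1\<close>.\<close>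
    have "\<exists>x. A $$ (i, j) = x * c ^ d \<and> (A $$ (i, j) = 0 \<longrightarrow> x = 0) \<and> (i = p \<and> j = q \<longrightarrow> x = u)"
      if "i < r" "j < s" for i j
    proof -
      consider "A $$ (i, j) = 0" | "i = p" "j = q" | "A $$ (i, j) \<noteq> 0" "\<not> (i = p \<and> j = q)" by blast
      then show ?thesis
      proof cases
        case 1
        then show ?thesis using nz by (intro exI[of _ 0]) auto
      next
        case 2
        then show ?thesis using pq nz by (intro exI[of _ u]) auto
      next
        case 3
        then obtain z l where z: "z \<in> invertible_elements" "l < n" "A $$ (i, j) = z * c ^ l"
          using unit_pow by blast
        then have "d \<le> l" unfolding d_def by (intro Least_le) (use that in \<open>auto simp: P_def\<close>)
        then have "A $$ (i, j) = z * c ^ (l - d) * c ^ d"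
          using z(3) by (simp add: mult.assoc flip: power_add)
        then show ?thesis using 3 by blast
      qed
    qed
    then obtain x where x: "\<And>i j. i < r \<Longrightarrow> j < s \<Longrightarrow> A $$ (i, j) = x i j * c ^ d"
      "\<And>i j. i < r \<Longrightarrow> j < s \<Longrightarrow> A $$ (i, j) = 0 \<Longrightarrow> x i j = 0" "x p q = u"
      using pq(1,2) by metis
    \<comment> \<open>The unit \<open>u\<close> is cancelled on the right for the column and on the
      left for the row, where centrality moves \<open>c ^ d\<close> out of the way.\<close>
    define v where "v i = x i q * u'" for i
    define w where "w j = u' * x p j" for j
    define A' where "A' = mat r s (\<lambda>(i, j). A $$ (i, j) - v i * A $$ (p, j))"
    have A'r: "A' \<in> rect_mats" using A by (simp add: A'_def rect_mats_def)
    have col: "A $$ (i, q) = v i * A $$ (p, q)" if "i < r" for i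
      using x(1)[OF that pq(2)] pq(4) u' by (simp add: v_def mult.assoc[symmetric])
        (simp add: mult.assoc u')
    have row: "A $$ (p, j) = A $$ (p, q) * w j" if "j < s" for j
    proof -
      have "A $$ (p, q) * w j = u * (c ^ d * (u' * x p j))" by (simp add: pq(4) w_def mult.assoc)
      also have "\<dots> = (u * u') * x p j * c ^ d" by (simp add: pow_central mult.assoc)
      finally show ?thesis using x(1)[OF pq(1) that] u' by simp
    qed
    have eq: "malc_class A = gen d + malc_class A'"
      unfolding gen_def
      by (rule malc_class_pivot[OF A(1) pq(1,2) col row pq(4) u'(1) _ _ A'_def])
        (simp_all add: v_def w_def x(3) u')
    let ?S = "\<lambda>A. {i. i < dim_row A \<and> (\<exists>j<dim_col A. A $$ (i, j) \<noteq> 0)}"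
    have "?S A' \<subset> ?S A"
    proof -
      have vp: "v p = 1" by (simp add: v_def x(3) u')
      have zero: "A' $$ (i, j) = 0" if "i < r" "j < s" "\<forall>l<s. A $$ (i, l) = 0" for i j
        using that x(2)[of i q] pq(2) by (simp add: A'_def v_def)
      have "?S A' \<subseteq> ?S A"
      proof
        fix i assume "i \<in> ?S A'"
        moreover have "dim_row A' = r" "dim_col A' = s" by (simp_all add: A'_def)
        ultimately obtain j where "i < r" "j < s" "A' $$ (i, j) \<noteq> 0" by auto
        then have "i < r" "\<exists>l<s. A $$ (i, l) \<noteq> 0" using zero by blast+
        then show "i \<in> ?S A" by (simp add: r_def s_def)
      qed
      moreover have "p \<in> ?S A" using nz pq by (auto simp: r_def s_def)
      moreover have "p \<notin> ?S A'" using pq(1) vp by (auto simp: A'_def)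
      ultimately show ?thesis by blast
    qed
    then have "card (?S A') < card (?S A)" by (intro psubset_card_mono) auto
    then obtain m where "malc_class A' = comb m" using less.hyps A'r by blast
    then have "malc_class A = comb (add1 m d)" using eq by (simp add: comb_add1 add.commute)
    then show ?thesis by blast
  qed
qed

lemma comb_surj: "\<exists>m. a = comb m"
  using malc_class_surj malc_class_eq_comb by metis

end

section \<open>Rank functions on the monoid of classes\<close>

lemma class_rank_mono:
  assumes "rk \<in> sylvester_rank_functions" "a \<le> b"
  shows "class_rank rk a \<le> class_rank rk b"
proof -
  obtain A B where "A \<in> rect_mats" "B \<in> rect_mats" "a = malc_class A" "b = malc_class B"
    using malc_class_surj by metis
  then show ?thesis
    using assms sylvester_rank_mono by (simp add: class_rank_malc_class malc_class_le_iff)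
qed

lemma class_rank_add:
  assumes "rk \<in> sylvester_rank_functions"
  shows "class_rank rk (a + b) = class_rank rk a + class_rank rk b"
proof -
  obtain A B where AB: "A \<in> rect_mats" "B \<in> rect_mats" "a = malc_class A" "b = malc_class B"
    using malc_class_surj by metis
  then have "class_rank rk (a + b) = rk (diag_sum A B)"
    using assms by (simp add: class_rank_malc_class diag_sum_rect flip: malc_class_diag_sum)
  also have "\<dots> = rk A + rk B" using assms AB by (auto simp: sylvester_rank_functions_def)
  finally show ?thesis using assms AB by (simp add: class_rank_malc_class)
qed

lemma class_rank_zero:
  assumes "rk \<in> sylvester_rank_functions"
  shows "class_rank rk 0 = 0"
  using class_rank_add[OF assms, of 0 0] by simp

lemma class_rank_sum:
  assumes "rk \<in> sylvester_rank_functions"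
  shows "class_rank rk (sum f I) = (\<Sum>i\<in>I. class_rank rk (f i))"
  by (induction I rule: infinite_finite_induct) (auto simp: class_rank_zero class_rank_add assms)

section \<open>Order, ranks and freeness\<close>

context chain_ring
begin

lemma class_rank_comb:
  assumes "0 < k" "k \<le> n"
  shows "class_rank (rank_k c n k) (comb m) = level n m k / k"
proof -
  have rk: "is_rank_k c n k (rank_k c n k)" by (rule is_rank_k_rank_k[OF assms])
  then have syl: "rank_k c n k \<in> sylvester_rank_functions" by (simp add: is_rank_k_def)
  have gen: "class_rank (rank_k c n k) (gen i) = real (k - i) / k" if "i < n" for i
  proof -
    have "rank_k c n k (elem_mat (c ^ i)) = real (k - i) / k"
      using rk that by (cases "i < k") (auto simp: is_rank_k_def of_nat_diff)
    then show ?thesis using syl by (simp add: gen_def class_rank_malc_class)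
  qed
  have "class_rank (rank_k c n k) (comb m) = (\<Sum>i<n. real (m i) * (real (k - i) / k))"
    unfolding comb_def by (simp add: class_rank_sum[OF syl] nat_multiple_def gen)
  then show ?thesis by (simp add: level_def sum_divide_distrib)
qed

lemma comb_le_iff_level: "comb m \<le> comb m' \<longleftrightarrow> (\<forall>k\<in>{1..n}. level n m k \<le> level n m' k)"
proof
  assume le: "comb m \<le> comb m'"
  show "\<forall>k\<in>{1..n}. level n m k \<le> level n m' k"
  proof
    fix k assume "k \<in> {1..n}"
    then have k: "0 < k" "k \<le> n" by auto
    have "rank_k c n k \<in> sylvester_rank_functions"
      using is_rank_k_rank_k[OF k] by (simp add: is_rank_k_def)
    from class_rank_mono[OF this le] show "level n m k \<le> level n m' k"
      using k by (simp add: class_rank_comb divide_le_cancel)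
  qed
next
  assume *: "\<forall>k\<in>{1..n}. level n m k \<le> level n m' k"
  show "comb m \<le> comb m'"
  proof (rule comb_mono)
    fix k assume "k \<le> n"
    \<comment> \<open>The ranks start at \<open>k = 1\<close>; for \<open>k = 0\<close> both levels
      are 0.\<close>
    then show "level n m k \<le> level n m' k" using * by (cases "k = 0") auto
  qed
qed

lemma comb_eqD:
  assumes "comb m = comb m'" "i < n"
  shows "m i = m' i"
proof (rule level_inj[OF _ assms(2)])
  fix k assume "k \<le> n"
  then show "level n m k = level n m' k"
    using comb_le_iff_level[of m m'] comb_le_iff_level[of m' m] assms(1)
    by (cases "k = 0") (auto intro!: antisym)
qed

text \<open>Multiplicities from \<open>n\<close> on do not affect \<open>comb\<close>, so uniqueness
  requires fixing them by restriction to \<open>{..<n}\<close>.\<close>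

lemma bij_betw_comb: "bij_betw comb ({..<n} \<rightarrow>\<^sub>E UNIV) UNIV"
proof (rule bij_betw_imageI)
  show "inj_on comb ({..<n} \<rightarrow>\<^sub>E UNIV)"
    by (rule inj_onI, rule PiE_ext) (auto dest: comb_eqD)
  show "comb ` ({..<n} \<rightarrow>\<^sub>E UNIV) = UNIV"
  proof (intro subset_antisym subset_UNIV subsetI)
    fix a
    obtain m where "a = comb m" using comb_surj by blast
    then have "a = comb (restrict m {..<n})" by (auto intro: comb_cong)
    moreover have "restrict m {..<n} \<in> {..<n} \<rightarrow>\<^sub>E UNIV" by simp
    ultimately show "a \<in> comb ` ({..<n} \<rightarrow>\<^sub>E UNIV)" by blast
  qed
qed

lemma le_iff_rank_k:
  "a \<le> b \<longleftrightarrow> (\<forall>k\<in>{1..n}. class_rank (rank_k c n k) a \<le> class_rank (rank_k c n k) b)"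
proof -
  obtain m m' where [simp]: "a = comb m" "b = comb m'" using comb_surj by metis
  show ?thesis
    unfolding comb_le_iff_level[of m m', folded \<open>a = comb m\<close> \<open>b = comb m'\<close>]
    by (intro ball_cong refl) (auto simp: class_rank_comb divide_le_cancel)
qed

end


section \<open>Local Artinian rings with principal radical\<close>

text \<open>A proper left ideal contains no invertible element, so the non-invertible elements form
  the only maximal left ideal.\<close>

lemma jacobson_radical_local:
  assumes "local_ring TYPE('a::ring_1)"
  shows "jacobson_radical = (- invertible_elements :: 'a set)"
proof -
  let ?N = "- invertible_elements :: 'a set"
  have N: "left_ideal ?N" using assms by (simp add: local_ring_def two_sided_ideal_def)
  have proper: "J \<subseteq> ?N" if J: "left_ideal J" "J \<noteq> UNIV" for J
  proof
    fix x assume x: "x \<in> J"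
    show "x \<in> ?N"
    proof
      assume "x \<in> invertible_elements"
      then obtain y where y: "y * x = 1" by (auto simp: invertible_elements_def)
      have "z \<in> J" for z
      proof -
        have "(z * y) * x \<in> J" using J(1) x unfolding left_ideal_def by blast
        then show ?thesis by (simp add: mult.assoc y)
      qed
      then show False using J(2) by blast
    qed
  qed
  have "(1 :: 'a) \<in> invertible_elements"
    by (auto simp: invertible_elements_def)
  then have "?N \<noteq> UNIV" by blast
  then have "{I. maximal_left_ideal I} = {?N}"
    using N proper unfolding maximal_left_ideal_def by blast
  then show ?thesis by (simp add: jacobson_radical_def)
qed

text \<open>As \<open>c\<close> is central, its left multiples already form a two-sided
  ideal.\<close>

lemma central_principal_ideal:
  assumes "c \<in> ring_center"
  shows "two_sided_ideal hull {c} \<subseteq> range (\<lambda>y. y * c)"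
proof (rule hull_minimal)
  show "{c} \<subseteq> range (\<lambda>y. y * c)" using rangeI[of "\<lambda>y. y * c" 1] by simp
  have c: "c * x = x * c" for x using assms by (auto simp: ring_center_def)
  show "two_sided_ideal (range (\<lambda>y. y * c))"
    unfolding two_sided_ideal_def left_ideal_def
  proof (intro conjI ballI allI)
    show "0 \<in> range (\<lambda>y. y * c)" using rangeI[of "\<lambda>y. y * c" 0] by simp
    fix x assume "x \<in> range (\<lambda>y. y * c)"
    then obtain a where a: "x = a * c" by blast
    show "r * x \<in> range (\<lambda>y. y * c)" for r
      using rangeI[of "\<lambda>y. y * c" "r * a"] by (simp add: a mult.assoc)
    show "x * r \<in> range (\<lambda>y. y * c)" for r
      using rangeI[of "\<lambda>y. y * c" "a * r"] by (simp add: a mult.assoc c)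
    fix y assume "y \<in> range (\<lambda>y. y * c)"
    then obtain b where b: "y = b * c" by blast
    show "x + y \<in> range (\<lambda>y. y * c)"
      using rangeI[of "\<lambda>y. y * c" "a + b"] by (simp add: a b distrib_right)
  qed
qed

text \<open>The left ideals of the powers of \<open>c\<close> stabilize, so
  \<open>(1 - y * c) * c ^ N = 0\<close> for some \<open>y\<close>. The factor
  \<open>1 - y * c\<close> is invertible, since otherwise 1 would lie in the ideal of non-invertible
  elements.\<close>

lemma nilpotent_of_left_artinian:
  fixes c :: "'a::ring_1"
  assumes "left_artinian TYPE('a)" "local_ring TYPE('a)" "c \<notin> invertible_elements"
  shows "\<exists>m. 0 < m \<and> c ^ m = 0"
proof -
  define I where "I k = range (\<lambda>y. y * c ^ k)" for k
  have "left_ideal (I k)" for k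
    unfolding left_ideal_def I_def
    by (auto simp: mult.assoc[symmetric] distrib_right[symmetric] intro: image_eqI[of _ _ 0])
  moreover have "I (Suc k) \<subseteq> I k" for k
    unfolding I_def by (auto simp: mult.assoc[symmetric])
  ultimately obtain N where N: "\<And>k. N \<le> k \<Longrightarrow> I k = I N"
    using assms(1) unfolding left_artinian_def by meson
  have "1 * c ^ N \<in> I N" unfolding I_def by blast
  then obtain y where y: "c ^ N = y * c ^ Suc N" using N[of "Suc N"] by (auto simp: I_def)
  have id: "two_sided_ideal (- invertible_elements :: 'a set)"
    using assms(2) by (simp add: local_ring_def)
  then have "y * c \<notin> invertible_elements"
    using assms(3) by (auto simp: two_sided_ideal_def left_ideal_def)
  moreover have "(1 :: 'a) \<in> invertible_elements" by (auto simp: invertible_elements_def)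
  moreover have "1 = (1 - y * c) + y * c" by simp
  ultimately have "1 - y * c \<in> invertible_elements"
    using id unfolding two_sided_ideal_def left_ideal_def by (metis ComplD ComplI)
  then obtain z where z: "z * (1 - y * c) = 1" by (auto simp: invertible_elements_def)
  have "(1 - y * c) * c ^ N = 0"
    using y by (simp add: left_diff_distrib mult.assoc)
  then have "z * (1 - y * c) * c ^ N = 0" by (simp add: mult.assoc)
  \<comment> \<open>\<open>c ^ N\<close> is already 0; the exponent \<open>Suc N\<close> is certain
    to be positive.\<close>
  then have "c ^ Suc N = 0" using z by simp
  then show ?thesis by blast
qed

lemma chain_ring_of_local_artinian:
  fixes c :: "'a::ring_1" and n :: nat
  assumes "left_artinian TYPE('a)" and loc: "local_ring TYPE('a)"
    and c: "c \<in> ring_center"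
    and rad: "jacobson_radical = two_sided_ideal hull {c}"
    and n: "n = (LEAST m. 0 < m \<and> c ^ m = 0)"
  shows "chain_ring c n"
proof
  have hull: "two_sided_ideal hull {c} = - invertible_elements"
    using jacobson_radical_local[OF loc] rad by simp
  have "c \<notin> invertible_elements"
    using hull_subset[of "{c}" two_sided_ideal] unfolding hull by simp
  note nil = nilpotent_of_left_artinian[OF assms(1) loc this]
  show pn: "c ^ n = 0" using LeastI_ex[OF nil] by (simp add: n)
  \<comment> \<open>Minimality of \<open>n\<close> concerns positive exponents only; for
    \<open>i = 0\<close> the power is 1, which is nonzero.\<close>
  show "c ^ i \<noteq> 0" if "i < n" for i
    using not_less_Least[OF that[unfolded n]] by (cases "i = 0") auto
  show "c * x = x * c" for x using c by (simp add: ring_center_def)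
  fix x :: 'a assume x: "x \<noteq> 0"
  have nonunit: "\<exists>z. y = z * c" if "y \<notin> invertible_elements" for y
    using central_principal_ideal[OF c] that unfolding hull by blast
  \<comment> \<open>Factors \<open>c\<close> are split off until a unit remains; for
    \<open>k = n\<close> the second alternative would give \<open>x = 0\<close>.\<close>
  have "(\<exists>u\<in>invertible_elements. \<exists>i<k. x = u * c ^ i) \<or> (\<exists>y. x = y * c ^ k)" for k
  proof (induction k)
    case 0
    show ?case by simp
  next
    case (Suc k)
    then show ?case
    proof
      assume "\<exists>y. x = y * c ^ k"
      then obtain y where y: "x = y * c ^ k" by blast
      show ?thesis
      proof (cases "y \<in> invertible_elements")
        case True
        then show ?thesis using y by blast
      next
        case False
        then obtain z where "y = z * c" using nonunit by blast
        then have "x = z * c ^ Suc k" using y by (simp add: mult.assoc)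
        then show ?thesis by blast
      qed
    qed (meson less_SucI)
  qed
  from this[of n] show "\<exists>u\<in>invertible_elements. \<exists>i<n. x = u * c ^ i"
    using x pn by auto
qed

theorem proposition3p7:
  fixes c :: "'a::ring_1" and n :: nat
  assumes "left_artinian TYPE('a)"
    and "local_ring TYPE('a)"
    and "c \<in> ring_center"
    and "jacobson_radical = two_sided_ideal hull {c}"
    and "n = (LEAST m. 0 < m \<and> c ^ m = 0)"
  shows "bij_betw (\<lambda>m. \<Sum>i<n. nat_multiple (m i) (malc_class (elem_mat (c ^ i))))
           ({..<n} \<rightarrow>\<^sub>E (UNIV :: nat set)) (UNIV :: 'a malc_semigroup set)
    \<and> (\<forall>a b :: 'a malc_semigroup.
         (a \<le> b \<longleftrightarrow> (\<forall>rk\<in>sylvester_rank_functions. class_rank rk a \<le> class_rank rk b))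
       \<and> ((\<forall>rk\<in>sylvester_rank_functions. class_rank rk a \<le> class_rank rk b)
           \<longleftrightarrow> (\<forall>k\<in>{1..n}. class_rank (rank_k c n k) a \<le> class_rank (rank_k c n k) b)))"
proof -
  interpret chain_ring c n by (rule chain_ring_of_local_artinian) (use assms in auto)
  have "comb = (\<lambda>m. \<Sum>i<n. nat_multiple (m i) (malc_class (elem_mat (c ^ i))))"
    by (simp add: fun_eq_iff comb_def gen_def)
  \<comment> \<open>This closes the circle: the order bounds all ranks, these include the rk_k, and
    the rk_k determine the order.\<close>
  moreover have "rank_k c n k \<in> sylvester_rank_functions" if "k \<in> {1..n}" for k
    using is_rank_k_rank_k[of k] that by (auto simp: is_rank_k_def)
  ultimately show ?thesis
    using bij_betw_comb class_rank_mono le_iff_rank_k by metis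
qed

end
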